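(* Let $(X_j,Y_j)_{j\ge 1}$ be i.i.d. real random pairs with continuous marginal distribution functions and copula $C$, where $C$ has continuous partial derivatives. Let $\alpha\in(0,1)$ and $i(n)=\alpha n$. Then the mean squared error of the nonparametric estimator $\widehat\lambda_{U,n}(i(n)/n)=\big(1-2\alpha+\widehat C_n(\alpha,\alpha)\big)/(1-\alpha)$ of the upper tail dependence coefficient $\lambda_U$ behaves asymptotically in the following manner: $$\mathbb{E}\left[\left(\widehat \lambda_{U,n}\left(\frac{i(n)}{n}\right)-\lambda_U\right)^2\right] = V_{U,n}(\alpha)+\left(\frac{1-2 \alpha+\delta(\alpha)}{1-\alpha} - 2+\delta'(1) \right)^{2},$$ where $$\lim_{n\to\infty} n\,V_{U,n}(\alpha)=\frac{\sigma^{2}(\alpha)}{(1-\alpha)^{2}}$$ and $$\sigma^2(\alpha)=\delta(\alpha)(1-\delta(\alpha)) +(1-\alpha)\left[\alpha\left(h_1(\alpha)^2+h_2(\alpha)^2\right)- 2 \delta(\alpha)\left(h_1(\alpha)+h_2(\alpha)\right)\right] + 2 h_1(\alpha)h_2(\alpha)\left(\delta(\alpha)-\alpha^2\right).$$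
   Context: The copula $C$ of a pair $(X,Y)$ with continuous marginal distribution functions $F_X,F_Y$ and joint distribution function $F$ is the function on $[0,1]^2$ with $F(x,y)=C(F_X(x),F_Y(y))$. The upper tail dependence coefficient is $\lambda_U=\lim_{u\to1^-}\frac{1-2u+C(u,u)}{1-u}$ (assumed to exist). The diagonal section of $C$ is $\delta(u)=C(u,u)$; $\delta'(1)$ is its (left) derivative at $1$, i.e. $\delta'(1)=\lim_{t\to1^-}\frac{1-C(t,t)}{1-t}$, so that $\lambda_U=2-\delta'(1)$. The h-functions are $h_1(u,v)=\partial C(u,v)/\partial u$ and $h_2(u,v)=\partial C(u,v)/\partial v$, and one writes $h_1(u)=h_1(u,u)$, $h_2(u)=h_2(u,u)$. Given $n$ observations $(X_j,Y_j)$, $1\le j\le n$, the empirical marginal distribution functions are $\widehat F_{X,n}(x)=\frac1n\sum_{j=1}^n \mathbf 1\{X_j\le x\}$ and $\widehat F_{Y,n}(y)=\frac1n\sum_{j=1}^n \mathbf 1\{Y_j\le y\}$, and the empirical copula is $$\widehat C_n(u,v)=\frac1n\sum_{j=1}^n \mathbf 1\{\widehat F_{X,n}(X_j)\le u\}\,\mathbf 1\{\widehat F_{Y,n}(Y_j)\le v\}.$$ The nonparametric estimator of the upper tail dependence coefficient with threshold $i$ is $$\widehat{\lambda}_{U,n}\left(\frac{i}{n}\right)=\frac{1-2 \frac{i}{n}+\widehat{C}_n\left(\frac{i}{n}, \frac{i}{n}\right)}{1-\frac{i}{n}}.$$ With $i=i(n)=\alpha n$ this formula is evaluated at $i(n)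/n=\alpha$.
   Formalization: The exact display fails (independence copula, α=1/2, odd n) as the estimator's bias differs from its limit by order 1/n; V is taken to be the estimator's variance and the squared term carries an added remainder r_n = o(n^{-1/2}) inside the square. *)

theory Defs
  imports "HOL-Probability.Probability" "HOL-Library.Landau_Symbols"
begin

text \<open>Bivariate copulas. They are total functions on the reals here, but only their values on
  the closed unit square are constrained.\<close>

definition copula :: "(real \<Rightarrow> real \<Rightarrow> real) \<Rightarrow> bool" where
  "copula C \<longleftrightarrow>
     (\<forall>u\<in>{0..1}. C u 0 = 0 \<and> C 0 u = 0 \<and> C u 1 = u \<and> C 1 u = u) \<and>
     (\<forall>u\<in>{0..1}. \<forall>u'\<in>{0..1}. \<forall>v\<in>{0..1}. \<forall>v'\<in>{0..1}.
        u \<le> u' \<longrightarrow> v \<le> v' \<longrightarrow> C u' v' - C u' v - C u v' + C u v \<ge> 0)"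

definition copula_of ::
    "'a measure \<Rightarrow> ('a \<Rightarrow> real) \<Rightarrow> ('a \<Rightarrow> real) \<Rightarrow> (real \<Rightarrow> real \<Rightarrow> real) \<Rightarrow> bool" where
  "copula_of M X Y C \<longleftrightarrow> copula C \<and>
     (\<forall>x y. measure M {\<omega> \<in> space M. X \<omega> \<le> x \<and> Y \<omega> \<le> y}
              = C (cdf (distr M borel X) x) (cdf (distr M borel Y) y))"

definition diagonal :: "(real \<Rightarrow> real \<Rightarrow> real) \<Rightarrow> real \<Rightarrow> real" where
  "diagonal C u = C u u"

definition left_deriv :: "(real \<Rightarrow> real) \<Rightarrow> real \<Rightarrow> real" where
  "left_deriv f x = Lim (at_left x) (\<lambda>t. (f x - f t) / (x - t))"

definition has_upper_tail_dependence :: "(real \<Rightarrow> real \<Rightarrow> real) \<Rightarrow> real \<Rightarrow> bool" where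
  "has_upper_tail_dependence C l \<longleftrightarrow>
     ((\<lambda>u. (1 - 2 * u + C u u) / (1 - u)) \<longlongrightarrow> l) (at_left 1)"

definition h1 :: "(real \<Rightarrow> real \<Rightarrow> real) \<Rightarrow> real \<Rightarrow> real \<Rightarrow> real" where
  "h1 C u v = deriv (\<lambda>s. C s v) u"

definition h2 :: "(real \<Rightarrow> real \<Rightarrow> real) \<Rightarrow> real \<Rightarrow> real \<Rightarrow> real" where
  "h2 C u v = deriv (\<lambda>s. C u s) v"

text \<open>Continuity of the partial derivatives is required on the open unit square only. A copula
  whose partial derivatives are continuous up to the corner \<open>(1,1)\<close> has diagonal derivative
  \<open>h1 C 1 1 + h2 C 1 1 = 2\<close> there, hence upper tail dependence coefficient \<open>0\<close>.\<close>

definition continuous_partials :: "(real \<Rightarrow> real \<Rightarrow> real) \<Rightarrow> bool" where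
  "continuous_partials C \<longleftrightarrow>
     (\<forall>u\<in>{0<..<1}. \<forall>v\<in>{0<..<1}.
        (\<lambda>s. C s v) field_differentiable (at u) \<and> (\<lambda>s. C u s) field_differentiable (at v)) \<and>
     continuous_on ({0<..<1} \<times> {0<..<1}) (\<lambda>(u, v). h1 C u v) \<and>
     continuous_on ({0<..<1} \<times> {0<..<1}) (\<lambda>(u, v). h2 C u v)"

definition iid_pairs :: "'a measure \<Rightarrow> (nat \<Rightarrow> 'a \<Rightarrow> real) \<Rightarrow> (nat \<Rightarrow> 'a \<Rightarrow> real) \<Rightarrow> bool" where
  "iid_pairs M X Y \<longleftrightarrow>
     prob_space.indep_vars M (\<lambda>_. borel) (\<lambda>j \<omega>. (X j \<omega>, Y j \<omega>)) {1..} \<and>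
     (\<forall>j\<ge>1. distr M borel (\<lambda>\<omega>. (X j \<omega>, Y j \<omega>)) = distr M borel (\<lambda>\<omega>. (X 1 \<omega>, Y 1 \<omega>)))"

text \<open>Empirical quantities of the observations \<open>(x j, y j)\<close> with \<open>1 \<le> j \<le> n\<close>.\<close>

definition emp_cdf :: "nat \<Rightarrow> (nat \<Rightarrow> real) \<Rightarrow> real \<Rightarrow> real" where
  "emp_cdf n x t = (1 / real n) * (\<Sum>j=1..n. of_bool (x j \<le> t))"

definition emp_copula ::
    "nat \<Rightarrow> (nat \<Rightarrow> real) \<Rightarrow> (nat \<Rightarrow> real) \<Rightarrow> real \<Rightarrow> real \<Rightarrow> real" where
  "emp_copula n x y u v =
     (1 / real n) * (\<Sum>j=1..n. of_bool (emp_cdf n x (x j) \<le> u) * of_bool (emp_cdf n y (y j) \<le> v))"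

definition upper_tail_estimator ::
    "nat \<Rightarrow> (nat \<Rightarrow> real) \<Rightarrow> (nat \<Rightarrow> real) \<Rightarrow> real \<Rightarrow> real" where
  "upper_tail_estimator n x y t = (1 - 2 * t + emp_copula n x y t t) / (1 - t)"

text \<open>The empirical copula is biased in general: for the independence copula and \<open>k = \<lfloor>n \<alpha>\<rfloor>\<close> its mean
  at \<open>(\<alpha>, \<alpha>)\<close> is \<open>(k / n)\<^sup>2\<close>. The bias of \<open>upper_tail_estimator\<close> therefore agrees with the limit
  \<open>(1 - 2 * \<alpha> + C \<alpha> \<alpha>) / (1 - \<alpha>) - \<lambda>\<close> only up to a remainder, and an expansion of the mean squared
  error into variance and squared limiting bias has to carry that remainder.\<close>

definition sigma2 :: "(real \<Rightarrow> real \<Rightarrow> real) \<Rightarrow> real \<Rightarrow> real" where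
  "sigma2 C \<alpha> =
     (let d = diagonal C \<alpha>; p = h1 C \<alpha> \<alpha>; q = h2 C \<alpha> \<alpha>
      in d * (1 - d) + (1 - \<alpha>) * (\<alpha> * (p\<^sup>2 + q\<^sup>2) - 2 * d * (p + q)) + 2 * p * q * (d - \<alpha>\<^sup>2))"

end

theory Submission
  imports Defs
begin

text \<open>Let \<open>H\<close> be the empirical joint distribution function and \<open>a\<close>, \<open>b\<close> the marginal \<open>\<alpha>\<close>-quantiles. With
  \<open>p = h1 C \<alpha> \<alpha>\<close> and \<open>q = h2 C \<alpha> \<alpha>\<close>, the empirical copula at \<open>(\<alpha>, \<alpha>)\<close> differs from the mean of the i.i.d.
  variables \<open>of_bool (X j \<le> a \<and> Y j \<le> b) - p * (of_bool (X j \<le> a) - \<alpha>) - q * (of_bool (Y j \<le> b) - \<alpha>)\<close>,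
  whose variance is \<open>sigma2 C \<alpha>\<close>, by an error that is \<open>o(1 / \<surd>n)\<close> in mean square. This gives both the
  variance asymptotics and a bias of order \<open>o(1 / \<surd>n)\<close>.

  The scaled error tends to zero in probability: if \<open>emp_cdf n x s \<le> \<alpha>\<close>, then every observation below
  \<open>s\<close> has normalised rank at most \<open>\<alpha>\<close>, and conversely if \<open>\<alpha> < emp_cdf n x s\<close>. Hence the empirical
  copula is sandwiched between values of \<open>H\<close> on a finite grid of points whose marginal probabilities
  are \<open>\<alpha> + i * \<eta> / \<surd>n\<close>, where Chebyshev's inequality and the differentiability of \<open>C\<close> apply. In the
  absence of ties the error is at most a combination of the marginal empirical processes at \<open>a\<close> and
  \<open>b\<close>, up to a constant, so its fourth moments are bounded and the convergence holds in mean square.\<close>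

section \<open>Moments\<close>

lemma (in prob_space) integrable_bounded:
  fixes f :: "'a \<Rightarrow> real"
  assumes "random_variable borel f" "\<And>\<omega>. \<omega> \<in> space M \<Longrightarrow> \<bar>f \<omega>\<bar> \<le> B"
  shows "integrable M f"
  by (rule integrable_const_bound[of _ B]) (use assms in auto)

text \<open>Induction on the index set: the new variable \<open>w\<close> is independent of the old
  sum \<open>S\<close>, and both are centred. In the expansions of \<open>(S + w)\<^sup>2\<close>
  and \<open>(S + w) ^ 4\<close> every term with a first power of \<open>S\<close> or
  \<open>w\<close> therefore drops out, so the fourth moment gains only
  \<open>6 * E S\<^sup>2 * E w\<^sup>2 + E w ^ 4\<close>. The resulting bound is quadratic in the
  number of summands, which is the order that cancels after division by
  \<open>sqrt n\<close>.\<close>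

lemma (in prob_space) centred_indep_sum_moments:
  fixes W :: "'i \<Rightarrow> 'a \<Rightarrow> real"
  assumes "finite I"
    and indep: "indep_vars (\<lambda>_. borel) W I"
    and bound: "\<And>j \<omega>. j \<in> I \<Longrightarrow> \<omega> \<in> space M \<Longrightarrow> \<bar>W j \<omega>\<bar> \<le> B"
    and centred: "\<And>j. j \<in> I \<Longrightarrow> expectation (W j) = 0"
  shows "expectation (\<lambda>\<omega>. (\<Sum>j\<in>I. W j \<omega>)\<^sup>2) = (\<Sum>j\<in>I. expectation (\<lambda>\<omega>. (W j \<omega>)\<^sup>2))"
    and "expectation (\<lambda>\<omega>. (\<Sum>j\<in>I. W j \<omega>) ^ 4) \<le> 3 * (real (card I))\<^sup>2 * B ^ 4"
proof -
  have "expectation (\<lambda>\<omega>. (\<Sum>j\<in>I. W j \<omega>)\<^sup>2) = (\<Sum>j\<in>I. expectation (\<lambda>\<omega>. (W j \<omega>)\<^sup>2)) \<and>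
     expectation (\<lambda>\<omega>. (\<Sum>j\<in>I. W j \<omega>) ^ 4) \<le> 3 * (real (card I))\<^sup>2 * B ^ 4"
    using assms
  proof (induction I rule: finite_induct)
    case empty
    then show ?case by simp
  next
    case (insert i I)
    define S where "S = (\<lambda>\<omega>. \<Sum>j\<in>I. W j \<omega>)"
    define w where "w = W i"
    have rv: "random_variable borel (W j)" if "j \<in> insert i I" for j
      using insert.prems(1) that by (auto simp: indep_vars_def)
    have [measurable]: "random_variable borel w" "random_variable borel S"
      using rv by (auto simp: w_def S_def)
    have bw: "\<bar>w \<omega>\<bar> \<le> B" if "\<omega> \<in> space M" for \<omega>
      using insert.prems(2)[of i \<omega>] that by (simp add: w_def)
    have B0: "0 \<le> B" using bw not_empty by fastforce
    have bS: "\<bar>S \<omega>\<bar> \<le> real (card I) * B" if "\<omega> \<in> space M" for \<omega>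
      unfolding S_def
      by (rule order_trans[OF sum_abs sum_bounded_above]) (use insert.prems(2) that in auto)
    have int [simp]: "integrable M (\<lambda>\<omega>. S \<omega> ^ k * w \<omega> ^ m)" for k m
    proof (rule integrable_bounded[of _ "(real (card I) * B) ^ k * B ^ m"])
      fix \<omega> assume "\<omega> \<in> space M"
      then show "\<bar>S \<omega> ^ k * w \<omega> ^ m\<bar> \<le> (real (card I) * B) ^ k * B ^ m"
        unfolding abs_mult power_abs using bS bw B0 by (intro mult_mono power_mono) auto
    qed measurable
    have [simp]: "integrable M (\<lambda>\<omega>. S \<omega> ^ k)" "integrable M (\<lambda>\<omega>. w \<omega> ^ k)" for k
      using int[of k 0] int[of 0 k] by simp_all
    have [simp]: "integrable M (\<lambda>\<omega>. S \<omega> * w \<omega>)" "integrable M (\<lambda>\<omega>. S \<omega> ^ k * w \<omega>)"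
      "integrable M (\<lambda>\<omega>. S \<omega> * w \<omega> ^ k)" for k
      using int[of 1 1] int[of k 1] int[of 1 k] by simp_all
    have iv: "indep_var borel w borel S"
      unfolding w_def S_def by (rule indep_vars_sum) (use insert in auto)
    have mult: "expectation (\<lambda>\<omega>. S \<omega> ^ k * w \<omega> ^ m)
        = expectation (\<lambda>\<omega>. S \<omega> ^ k) * expectation (\<lambda>\<omega>. w \<omega> ^ m)" for k m
    proof -
      have "indep_var borel ((\<lambda>x. x ^ m) \<circ> w) borel ((\<lambda>x. x ^ k) \<circ> S)"
        by (rule indep_var_compose[OF iv]) auto
      from indep_var_lebesgue_integral[OF this] show ?thesis by (simp add: comp_def mult.commute)
    qed
    have sub: "indep_vars (\<lambda>_. borel) W I" by (rule indep_vars_subset[OF insert.prems(1)]) auto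
    have IH: "expectation (\<lambda>\<omega>. S \<omega> ^ 2) = (\<Sum>j\<in>I. expectation (\<lambda>\<omega>. (W j \<omega>)\<^sup>2))"
      "expectation (\<lambda>\<omega>. S \<omega> ^ 4) \<le> 3 * (real (card I))\<^sup>2 * B ^ 4"
      using insert.IH[OF sub] insert.prems unfolding S_def by auto
    have w1: "expectation w = 0" using insert.prems(3)[of i] by (simp add: w_def)
    have S1: "expectation S = 0"
    proof -
      have "integrable M (W j)" if "j \<in> I" for j
        using insert.prems(2) rv that by (intro integrable_bounded[of _ B]) auto
      then show ?thesis
        unfolding S_def using insert.prems(3) by (subst Bochner_Integration.integral_sum) auto
    qed
    have pw: "w \<omega> ^ (2 * k) \<le> B ^ (2 * k)" if "\<omega> \<in> space M" for \<omega> k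
      using power_mono[OF bw[OF that], of "2 * k"] by (simp add: power_mult)
    have Ew: "expectation (\<lambda>\<omega>. w \<omega> ^ (2 * k)) \<le> B ^ (2 * k)" for k
      by (rule integral_le_const) (use pw in auto)
    have EW: "expectation (\<lambda>\<omega>. (W j \<omega>)\<^sup>2) \<le> B\<^sup>2" if "j \<in> I" for j
    proof (rule integral_le_const)
      have "(W j \<omega>)\<^sup>2 \<le> B\<^sup>2" if "\<omega> \<in> space M" for \<omega>
        using insert.prems(2)[of j \<omega>] that \<open>j \<in> I\<close> by (simp add: abs_le_square_iff[symmetric])
      then show "integrable M (\<lambda>\<omega>. (W j \<omega>)\<^sup>2)" "AE \<omega> in M. (W j \<omega>)\<^sup>2 \<le> B\<^sup>2"
        using rv that by (auto intro!: integrable_bounded[of _ "B\<^sup>2"])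
    qed
    have ES2: "expectation (\<lambda>\<omega>. S \<omega> ^ 2) \<le> real (card I) * B ^ 2"
      unfolding IH
      by (rule sum_bounded_above) (rule EW)
    \<comment> \<open>The explicit exponents 1 keep each mixed term in the shape of
      \<open>mult\<close>, so that its expectation factorises.\<close>
    have e2: "(\<Sum>j\<in>insert i I. W j \<omega>)\<^sup>2 = S \<omega> ^ 2 + (2 * (S \<omega> ^ 1 * w \<omega> ^ 1) + w \<omega> ^ 2)" for \<omega>
      using insert.hyps by (simp add: S_def w_def power2_eq_square algebra_simps)
    have e4: "(\<Sum>j\<in>insert i I. W j \<omega>) ^ 4 = S \<omega> ^ 4 + (4 * (S \<omega> ^ 3 * w \<omega> ^ 1)
        + (6 * (S \<omega> ^ 2 * w \<omega> ^ 2) + (4 * (S \<omega> ^ 1 * w \<omega> ^ 3) + w \<omega> ^ 4)))" for \<omega>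
      using insert.hyps by (simp add: S_def w_def eval_nat_numeral algebra_simps)
    have E2: "expectation (\<lambda>\<omega>. (\<Sum>j\<in>insert i I. W j \<omega>)\<^sup>2)
        = expectation (\<lambda>\<omega>. S \<omega> ^ 2) + (2 * (expectation (\<lambda>\<omega>. S \<omega> ^ 1) * expectation (\<lambda>\<omega>. w \<omega> ^ 1)) + expectation (\<lambda>\<omega>. w \<omega> ^ 2))"
      unfolding e2 mult[symmetric] by simp
    have E4: "expectation (\<lambda>\<omega>. (\<Sum>j\<in>insert i I. W j \<omega>) ^ 4)
        = expectation (\<lambda>\<omega>. S \<omega> ^ 4) + (4 * (expectation (\<lambda>\<omega>. S \<omega> ^ 3) * expectation (\<lambda>\<omega>. w \<omega> ^ 1))
        + (6 * (expectation (\<lambda>\<omega>. S \<omega> ^ 2) * expectation (\<lambda>\<omega>. w \<omega> ^ 2))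
        + (4 * (expectation (\<lambda>\<omega>. S \<omega> ^ 1) * expectation (\<lambda>\<omega>. w \<omega> ^ 3)) + expectation (\<lambda>\<omega>. w \<omega> ^ 4))))"
      unfolding e4 mult[symmetric] by simp
    have "expectation (\<lambda>\<omega>. S \<omega> ^ 2) * expectation (\<lambda>\<omega>. w \<omega> ^ 2) \<le> (real (card I) * B ^ 2) * B ^ 2"
      using ES2 Ew[of 1] B0 by (intro mult_mono) auto
    then have "expectation (\<lambda>\<omega>. (\<Sum>j\<in>insert i I. W j \<omega>) ^ 4)
        \<le> 3 * (real (card I))\<^sup>2 * B ^ 4 + (6 * (real (card I) * B ^ 2 * B ^ 2) + B ^ 4)"
      unfolding E4 using IH(2) w1 S1 Ew[of 2] by simp
    \<comment> \<open>With \<open>m = card I\<close> this is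
      \<open>3 * m\<^sup>2 + 6 * m + 1 \<le> 3 * (m + 1)\<^sup>2\<close>.\<close>
    also have "\<dots> \<le> 3 * (real (card (insert i I)))\<^sup>2 * B ^ 4"
      using insert.hyps B0 by (simp add: algebra_simps power2_eq_square eval_nat_numeral)
    finally show ?case
      unfolding E2 using IH(1) w1 S1 insert.hyps by (simp add: w_def)
  qed
  then show "expectation (\<lambda>\<omega>. (\<Sum>j\<in>I. W j \<omega>)\<^sup>2) = (\<Sum>j\<in>I. expectation (\<lambda>\<omega>. (W j \<omega>)\<^sup>2))"
    and "expectation (\<lambda>\<omega>. (\<Sum>j\<in>I. W j \<omega>) ^ 4) \<le> 3 * (real (card I))\<^sup>2 * B ^ 4" by auto
qed

section \<open>Mean-square convergence and moments under a vanishing perturbation\<close>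

context prob_space begin

text \<open>Bounded fourth moments make the squares uniformly integrable, so convergence in
  probability becomes convergence in mean square. The quantitative form used is that the square is
  at most \<open>\<epsilon>\<^sup>2\<close> where
  \<open>\<bar>D n \<omega>\<bar> \<le> \<epsilon>\<close>, and at most
  \<open>\<tau> * D n \<omega> ^ 4 + 1 / \<tau>\<close> on the remaining event.\<close>

lemma second_moment_tendsto_zero:
  fixes D :: "nat \<Rightarrow> 'a \<Rightarrow> real"
  assumes [measurable]: "\<And>n. random_variable borel (D n)"
    and int4: "\<And>n. integrable M (\<lambda>\<omega>. D n \<omega> ^ 4)"
    and moment: "\<forall>\<^sub>F n in sequentially. expectation (\<lambda>\<omega>. D n \<omega> ^ 4) \<le> B"
    and conv: "\<And>\<epsilon>. 0 < \<epsilon> \<Longrightarrow> (\<lambda>n. prob {\<omega> \<in> space M. \<epsilon> < \<bar>D n \<omega>\<bar>}) \<longlonglongrightarrow> 0"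
  shows "(\<lambda>n. expectation (\<lambda>\<omega>. (D n \<omega>)\<^sup>2)) \<longlonglongrightarrow> 0"
proof (rule LIMSEQ_I)
  fix r :: real assume r: "0 < r"
  \<comment> \<open>The three terms of the estimate \<open>le\<close> get at most
    \<open>r / 4\<close> each: the first through \<epsilon>, the second through \<tau>, the third
    because the probability is eventually below \<open>r * \<tau> / 4\<close>. The summand 1 in the
    denominator of \<tau> covers \<open>B = 0\<close>.\<close>
  define \<epsilon> where "\<epsilon> = sqrt (r / 4)"
  define \<tau> where "\<tau> = r / (4 * (\<bar>B\<bar> + 1))"
  have \<epsilon>: "0 < \<epsilon>" "\<epsilon>\<^sup>2 = r / 4" using r by (auto simp: \<epsilon>_def)
  have \<tau>: "0 < \<tau>" "\<tau> * B \<le> r / 4"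
  proof -
    show "0 < \<tau>" using r by (auto simp: \<tau>_def)
    have "\<tau> * B \<le> \<tau> * (\<bar>B\<bar> + 1)" using \<open>0 < \<tau>\<close> by (intro mult_left_mono) auto
    also have "\<dots> = r / 4" by (simp add: \<tau>_def field_simps)
    finally show "\<tau> * B \<le> r / 4" .
  qed
  let ?A = "\<lambda>n. {\<omega> \<in> space M. \<epsilon> < \<bar>D n \<omega>\<bar>}"
  have le: "expectation (\<lambda>\<omega>. (D n \<omega>)\<^sup>2) \<le> \<epsilon>\<^sup>2 + (\<tau> * expectation (\<lambda>\<omega>. D n \<omega> ^ 4) + prob (?A n) / \<tau>)" for n
  proof -
    have "(D n \<omega>)\<^sup>2 \<le> \<epsilon>\<^sup>2 + (\<tau> * D n \<omega> ^ 4 + indicator (?A n) \<omega> / \<tau>)" if "\<omega> \<in> space M" for \<omega>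
    proof (cases "\<epsilon> < \<bar>D n \<omega>\<bar>")
      case True
      have "0 \<le> (\<tau> * (D n \<omega>)\<^sup>2 - 1)\<^sup>2" "0 \<le> (\<tau> * (D n \<omega>)\<^sup>2)" using \<tau> by auto
      then have "\<tau> * (D n \<omega>)\<^sup>2 \<le> \<tau>\<^sup>2 * D n \<omega> ^ 4 + 1"
        by (simp add: power2_diff power_mult_distrib flip: power_mult)
      then have "(D n \<omega>)\<^sup>2 \<le> \<tau> * D n \<omega> ^ 4 + 1 / \<tau>"
        using \<tau>(1) by (simp add: field_simps power2_eq_square)
      then show ?thesis using True that \<epsilon> by (simp add: add_increasing)
    next
      case False
      then have "(D n \<omega>)\<^sup>2 \<le> \<epsilon>\<^sup>2" using \<epsilon> by (simp add: abs_le_square_iff[symmetric])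
      then show ?thesis using False \<tau>(1) by (simp add: add_increasing2)
    qed
    moreover have ind: "integrable M (indicator (?A n) :: 'a \<Rightarrow> real)"
      by (intro integrable_real_indicator) (auto simp: emeasure_eq_measure)
    then have "integrable M (\<lambda>\<omega>. \<epsilon>\<^sup>2 + (\<tau> * D n \<omega> ^ 4 + indicator (?A n) \<omega> / \<tau>))"
      using int4 by simp
    ultimately have "expectation (\<lambda>\<omega>. (D n \<omega>)\<^sup>2)
        \<le> expectation (\<lambda>\<omega>. \<epsilon>\<^sup>2 + (\<tau> * D n \<omega> ^ 4 + indicator (?A n) \<omega> / \<tau>))"
      using \<tau>(1) by (intro integral_mono') auto
    also have "\<dots> = \<epsilon>\<^sup>2 + (\<tau> * expectation (\<lambda>\<omega>. D n \<omega> ^ 4) + prob (?A n) / \<tau>)"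
      using int4 ind by (simp add: prob_space Int_absorb1)
    finally show ?thesis .
  qed
  have "\<forall>\<^sub>F n in sequentially. prob (?A n) < r * \<tau> / 4"
    by (rule order_tendstoD(2)[OF conv[OF \<epsilon>(1)]]) (use r \<tau> in simp)
  with moment have "\<forall>\<^sub>F n in sequentially. norm (expectation (\<lambda>\<omega>. (D n \<omega>)\<^sup>2) - 0) < r"
  proof eventually_elim
    case (elim n)
    have "\<tau> * expectation (\<lambda>\<omega>. D n \<omega> ^ 4) \<le> \<tau> * B" using elim(1) \<tau> by (intro mult_left_mono) auto
    moreover have "prob (?A n) / \<tau> < r / 4" using elim(2) \<tau> by (simp add: field_simps)
    ultimately have "expectation (\<lambda>\<omega>. (D n \<omega>)\<^sup>2) < r" using le[of n] \<tau> \<epsilon> r by linarith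
    moreover have "0 \<le> expectation (\<lambda>\<omega>. (D n \<omega>)\<^sup>2)" by (rule integral_nonneg_AE) auto
    ultimately show ?case by simp
  qed
  then show "\<exists>no. \<forall>n\<ge>no. norm (expectation (\<lambda>\<omega>. (D n \<omega>)\<^sup>2) - 0) < r"
    by (simp add: eventually_sequentially)
qed

text \<open>The Cauchy-Schwarz argument in weighted form,
  \<open>2 * \<bar>L * D\<bar> \<le> t * L\<^sup>2 + D\<^sup>2 / t\<close>, with a weight
  \<open>t\<close> that tends to zero but is no smaller than the root mean square of
  \<open>D\<close>.\<close>

lemma expectation_mult_tendsto_zero:
  fixes L D :: "nat \<Rightarrow> 'a \<Rightarrow> real"
  assumes [measurable]: "\<And>n. random_variable borel (L n)" "\<And>n. random_variable borel (D n)"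
    and L2: "\<And>n. integrable M (\<lambda>\<omega>. (L n \<omega>)\<^sup>2)" and D2: "\<And>n. integrable M (\<lambda>\<omega>. (D n \<omega>)\<^sup>2)"
    and L: "(\<lambda>n. expectation (\<lambda>\<omega>. (L n \<omega>)\<^sup>2)) \<longlonglongrightarrow> s"
    and D: "(\<lambda>n. expectation (\<lambda>\<omega>. (D n \<omega>)\<^sup>2)) \<longlonglongrightarrow> 0"
  shows "(\<lambda>n. expectation (\<lambda>\<omega>. L n \<omega> * D n \<omega>)) \<longlonglongrightarrow> 0"
proof -
  define d where "d n = sqrt (expectation (\<lambda>\<omega>. (D n \<omega>)\<^sup>2))" for n
  \<comment> \<open>The second summand keeps the weight positive when \<open>d n = 0\<close>, so
    that division by it is legitimate.\<close>
  define t where "t n = d n + 1 / Suc n" for n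
  have d0: "0 \<le> d n" for n by (simp add: d_def)
  have dd: "expectation (\<lambda>\<omega>. (D n \<omega>)\<^sup>2) = (d n)\<^sup>2" for n by (simp add: d_def)
  have d: "d \<longlonglongrightarrow> 0" unfolding d_def using tendsto_real_sqrt[OF D] by simp
  have t0: "0 < t n" for n using d0[of n] by (simp add: t_def add_nonneg_pos)
  have t: "t \<longlonglongrightarrow> 0" unfolding t_def using tendsto_add[OF d LIMSEQ_inverse_real_of_nat]
    by (simp add: divide_inverse)
  have bound: "\<bar>expectation (\<lambda>\<omega>. L n \<omega> * D n \<omega>)\<bar> \<le> (t n * expectation (\<lambda>\<omega>. (L n \<omega>)\<^sup>2) + d n) / 2" for n
  proof -
    have *: "\<bar>L n \<omega> * D n \<omega>\<bar> \<le> (t n * (L n \<omega>)\<^sup>2 + (D n \<omega>)\<^sup>2 / t n) / 2" for \<omega>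
    proof -
      have "0 \<le> (t n * \<bar>L n \<omega>\<bar> - \<bar>D n \<omega>\<bar>)\<^sup>2" by simp
      then have "2 * t n * \<bar>L n \<omega> * D n \<omega>\<bar> \<le> (t n)\<^sup>2 * (L n \<omega>)\<^sup>2 + (D n \<omega>)\<^sup>2"
        by (simp add: power2_diff power_mult_distrib abs_mult)
      then show ?thesis using t0[of n] by (simp add: field_simps power2_eq_square)
    qed
    have "\<bar>expectation (\<lambda>\<omega>. L n \<omega> * D n \<omega>)\<bar> \<le> expectation (\<lambda>\<omega>. \<bar>L n \<omega> * D n \<omega>\<bar>)"
      by (rule integral_abs_bound)
    also have "\<dots> \<le> expectation (\<lambda>\<omega>. (t n * (L n \<omega>)\<^sup>2 + (D n \<omega>)\<^sup>2 / t n) / 2)"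
      by (rule integral_mono') (use * L2 D2 t0[of n] in \<open>auto intro!: divide_nonneg_pos add_nonneg_nonneg\<close>)
    also have "\<dots> = (t n * expectation (\<lambda>\<omega>. (L n \<omega>)\<^sup>2) + (d n)\<^sup>2 / t n) / 2"
      using L2 D2 by (simp add: dd)
    also have "(d n)\<^sup>2 / t n \<le> d n"
    proof -
      have "d n * d n \<le> d n * t n" using d0[of n] by (intro mult_left_mono) (auto simp: t_def)
      then show ?thesis using t0[of n] by (simp add: field_simps power2_eq_square)
    qed
    finally show ?thesis by simp
  qed
  have "(\<lambda>n. (t n * expectation (\<lambda>\<omega>. (L n \<omega>)\<^sup>2) + d n) / 2) \<longlonglongrightarrow> (0 * s + 0) / 2"
    by (intro tendsto_intros t L d) simp
  then have lim: "(\<lambda>n. (t n * expectation (\<lambda>\<omega>. (L n \<omega>)\<^sup>2) + d n) / 2) \<longlonglongrightarrow> 0"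
    by (simp only: mult_zero_left add_0 div_0)
  show ?thesis
    by (rule Lim_null_comparison[OF _ lim]) (simp only: real_norm_def bound eventually_True)
qed

text \<open>Since \<open>L n\<close> is centred, the mean of the sum is that of \<open>D n\<close>.
  In the variance the cross term and the square of \<open>D n\<close> vanish in the limit, so only
  the second moment of \<open>L n\<close> survives.\<close>

lemma mean_variance_tendsto_perturbed:
  fixes L D :: "nat \<Rightarrow> 'a \<Rightarrow> real"
  assumes [measurable]: "\<And>n. random_variable borel (L n)" "\<And>n. random_variable borel (D n)"
    and L2: "\<And>n. integrable M (\<lambda>\<omega>. (L n \<omega>)\<^sup>2)" and D2: "\<And>n. integrable M (\<lambda>\<omega>. (D n \<omega>)\<^sup>2)"
    and L0: "\<And>n. expectation (L n) = 0"
    and L: "(\<lambda>n. expectation (\<lambda>\<omega>. (L n \<omega>)\<^sup>2)) \<longlonglongrightarrow> s"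
    and D: "(\<lambda>n. expectation (\<lambda>\<omega>. (D n \<omega>)\<^sup>2)) \<longlonglongrightarrow> 0"
  shows "(\<lambda>n. expectation (\<lambda>\<omega>. L n \<omega> + D n \<omega>)) \<longlonglongrightarrow> 0"
    and "(\<lambda>n. variance (\<lambda>\<omega>. L n \<omega> + D n \<omega>)) \<longlonglongrightarrow> s"
proof -
  have L1: "integrable M (L n)" and D1: "integrable M (D n)" for n
    by (rule square_integrable_imp_integrable[OF assms(1) L2], rule square_integrable_imp_integrable[OF assms(2) D2])
  have LD: "integrable M (\<lambda>\<omega>. L n \<omega> * D n \<omega>)" for n
  proof (rule Bochner_Integration.integrable_bound[of _ "\<lambda>\<omega>. (L n \<omega>)\<^sup>2 + (D n \<omega>)\<^sup>2"])
    have "\<bar>a * b\<bar> \<le> a\<^sup>2 + b\<^sup>2" for a b :: real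
    proof -
      have "0 \<le> \<bar>a * b\<bar>" "2 * \<bar>a * b\<bar> \<le> a\<^sup>2 + b\<^sup>2"
        using sum_squares_bound[of "\<bar>a\<bar>" "\<bar>b\<bar>"] by (simp_all add: abs_mult)
      then show ?thesis by linarith
    qed
    then show "AE \<omega> in M. norm (L n \<omega> * D n \<omega>) \<le> norm ((L n \<omega>)\<^sup>2 + (D n \<omega>)\<^sup>2)" by simp
  qed (use L2 D2 in auto)
  \<comment> \<open>The product lemma with the constant 1 as first factor shows that the means of
    \<open>D n\<close> vanish.\<close>
  have "(\<lambda>n. expectation (\<lambda>\<omega>. 1 * D n \<omega>)) \<longlonglongrightarrow> 0"
    by (rule expectation_mult_tendsto_zero[where s = 1]) (use D2 D in \<open>auto simp: prob_space\<close>)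
  then have mD: "(\<lambda>n. expectation (D n)) \<longlonglongrightarrow> 0" by simp
  have m: "expectation (\<lambda>\<omega>. L n \<omega> + D n \<omega>) = expectation (D n)" for n
    using L1 D1 L0 by simp
  then show "(\<lambda>n. expectation (\<lambda>\<omega>. L n \<omega> + D n \<omega>)) \<longlonglongrightarrow> 0" using mD by simp
  have sq: "(L n \<omega> + D n \<omega>)\<^sup>2 = (L n \<omega>)\<^sup>2 + (2 * (L n \<omega> * D n \<omega>) + (D n \<omega>)\<^sup>2)" for n \<omega>
    by (simp add: power2_sum)
  have "variance (\<lambda>\<omega>. L n \<omega> + D n \<omega>) = expectation (\<lambda>\<omega>. (L n \<omega>)\<^sup>2)
      + (2 * expectation (\<lambda>\<omega>. L n \<omega> * D n \<omega>) + expectation (\<lambda>\<omega>. (D n \<omega>)\<^sup>2)) - (expectation (D n))\<^sup>2" for n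
    using L1 D1 LD L2 D2 by (subst variance_eq) (simp_all only: sq m, simp_all)
  moreover have "(\<lambda>n. expectation (\<lambda>\<omega>. (L n \<omega>)\<^sup>2)
      + (2 * expectation (\<lambda>\<omega>. L n \<omega> * D n \<omega>) + expectation (\<lambda>\<omega>. (D n \<omega>)\<^sup>2)) - (expectation (D n))\<^sup>2)
      \<longlonglongrightarrow> s + (2 * 0 + 0) - 0\<^sup>2"
    by (intro tendsto_intros L D mD expectation_mult_tendsto_zero[where s = s] L2 D2) simp_all
  ultimately show "(\<lambda>n. variance (\<lambda>\<omega>. L n \<omega> + D n \<omega>)) \<longlonglongrightarrow> s" by simp
qed

end

text \<open>The bias-variance decomposition.\<close>

lemma (in prob_space) mean_squared_error:
  fixes T :: "'a \<Rightarrow> real"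
  assumes "integrable M T" "integrable M (\<lambda>\<omega>. (T \<omega>)\<^sup>2)"
  shows "expectation (\<lambda>\<omega>. (T \<omega> - l)\<^sup>2) = variance T + (expectation T - l)\<^sup>2"
proof -
  have "expectation (\<lambda>\<omega>. (T \<omega> - l)\<^sup>2) = expectation (\<lambda>\<omega>. (T \<omega>)\<^sup>2 - (2 * l * T \<omega> - l\<^sup>2))"
    by (rule Bochner_Integration.integral_cong) (simp_all add: power2_diff)
  also have "\<dots> = expectation (\<lambda>\<omega>. (T \<omega>)\<^sup>2) - (2 * l * expectation T - l\<^sup>2)"
    using assms by (simp add: prob_space)
  finally show ?thesis
    unfolding variance_eq[OF assms] by (simp add: power2_diff)
qed

text \<open>The inequality \<open>(u + v + w)\<^sup>2 \<le> 3 * (u\<^sup>2 + v\<^sup>2 +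
  w\<^sup>2)\<close> is applied first to the numbers and then to their squares, whence
  \<open>27 = 3\<^sup>2 * 3\<close>.\<close>

lemma power4_sum3_le: "(x + y + z) ^ 4 \<le> 27 * (x ^ 4 + y ^ 4 + z ^ 4)" for x y z :: real
proof -
  have sq: "(u + v + w)\<^sup>2 \<le> 3 * (u\<^sup>2 + v\<^sup>2 + w\<^sup>2)" for u v w :: real
  proof -
    have "0 \<le> (u - v)\<^sup>2 + (v - w)\<^sup>2 + (u - w)\<^sup>2" by simp
    then show ?thesis by (simp add: power2_eq_square algebra_simps)
  qed
  have "((x + y + z)\<^sup>2)\<^sup>2 \<le> (3 * (x\<^sup>2 + y\<^sup>2 + z\<^sup>2))\<^sup>2" by (rule power_mono[OF sq]) simp
  also have "\<dots> = 9 * (x\<^sup>2 + y\<^sup>2 + z\<^sup>2)\<^sup>2" by (simp only: power_mult_distrib) simp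
  also have "\<dots> \<le> 9 * (3 * ((x\<^sup>2)\<^sup>2 + (y\<^sup>2)\<^sup>2 + (z\<^sup>2)\<^sup>2))"
    by (rule mult_left_mono[OF sq]) simp
  finally show ?thesis by simp
qed

section \<open>Empirical processes of i.i.d. samples\<close>

locale iid_sample = prob_space M for M :: "'a measure" +
  fixes N :: "'b measure" and Z :: "nat \<Rightarrow> 'a \<Rightarrow> 'b"
  assumes indep: "indep_vars (\<lambda>_. N) Z {1..}"
    and ident: "\<And>j. 1 \<le> j \<Longrightarrow> distr M N (Z j) = distr M N (Z 1)"
begin

text \<open>The expectation is subtracted from each summand. At \<open>n = 0\<close> the value is 0,
  so the bounds that do not assume \<open>1 \<le> n\<close> hold there as well.\<close>

definition emp_process :: "('b \<Rightarrow> real) \<Rightarrow> nat \<Rightarrow> 'a \<Rightarrow> real" where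
  "emp_process f n \<omega> = (\<Sum>j=1..n. f (Z j \<omega>) - expectation (\<lambda>\<omega>. f (Z 1 \<omega>))) / sqrt (real n)"

lemma measurable_Z [measurable (raw)]: "1 \<le> j \<Longrightarrow> Z j \<in> measurable M N"
  using indep by (auto simp: indep_vars_def)

lemma expectation_Z:
  assumes "1 \<le> j" "f \<in> borel_measurable N"
  shows "expectation (\<lambda>\<omega>. f (Z j \<omega>)) = expectation (\<lambda>\<omega>. f (Z 1 \<omega>) :: real)"
  using integral_distr[OF measurable_Z[OF assms(1)] assms(2)]
    integral_distr[OF measurable_Z[of 1] assms(2)] ident[OF assms(1)] by simp

context
  fixes f :: "'b \<Rightarrow> real" and B :: real
  assumes f [measurable]: "f \<in> borel_measurable N" and bound: "\<And>z. \<bar>f z\<bar> \<le> B"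
begin

lemma integrable_Z: "1 \<le> j \<Longrightarrow> integrable M (\<lambda>\<omega>. f (Z j \<omega>))"
  by (rule integrable_bounded[of _ B]) (use bound in auto)

lemma measurable_emp_process [measurable]: "random_variable borel (emp_process f n)"
  unfolding emp_process_def by measurable

lemma centred_Z:
  assumes "1 \<le> j"
  shows "expectation (\<lambda>\<omega>. f (Z j \<omega>) - expectation (\<lambda>\<omega>. f (Z 1 \<omega>))) = 0"
    and "\<bar>f (Z j \<omega>) - expectation (\<lambda>\<omega>. f (Z 1 \<omega>))\<bar> \<le> 2 * B"
proof -
  show "expectation (\<lambda>\<omega>. f (Z j \<omega>) - expectation (\<lambda>\<omega>. f (Z 1 \<omega>))) = 0"
    using integrable_Z[OF assms] expectation_Z[OF assms f] by (simp add: prob_space)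
  have "\<bar>expectation (\<lambda>\<omega>. f (Z 1 \<omega>))\<bar> \<le> expectation (\<lambda>\<omega>. \<bar>f (Z 1 \<omega>)\<bar>)" by (rule integral_abs_bound)
  also have "\<dots> \<le> B"
    by (rule integral_le_const) (use bound integrable_Z[of 1] in auto)
  finally show "\<bar>f (Z j \<omega>) - expectation (\<lambda>\<omega>. f (Z 1 \<omega>))\<bar> \<le> 2 * B"
    using bound[of "Z j \<omega>"] by linarith
qed

text \<open>A crude pointwise bound of order \<open>sqrt n\<close>, meant for integrability; the
  estimates uniform in \<open>n\<close> are those of \<open>emp_process_moments\<close>.\<close>

lemma emp_process_bound: "\<bar>emp_process f n \<omega>\<bar> \<le> real n * (2 * B) / sqrt (real n)"
proof -
  have "\<bar>\<Sum>j=1..n. f (Z j \<omega>) - expectation (\<lambda>\<omega>. f (Z 1 \<omega>))\<bar> \<le> real (card {1..n}) * (2 * B)"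
    by (rule order_trans[OF sum_abs sum_bounded_above]) (use centred_Z(2) in auto)
  then show ?thesis unfolding emp_process_def by (simp add: divide_right_mono)
qed

lemma integrable_emp_process_power: "integrable M (\<lambda>\<omega>. emp_process f n \<omega> ^ k)"
  by (rule integrable_bounded[of _ "(real n * (2 * B) / sqrt (real n)) ^ k"])
    (auto simp: power_abs intro!: power_mono emp_process_bound)

text \<open>The centred summands are bounded by \<open>2 * B\<close>, so
  \<open>centred_indep_sum_moments\<close> applies. The factor \<open>n\<close> in the second moment
  and \<open>n\<^sup>2\<close> in the fourth cancel against the powers of
  \<open>sqrt n\<close>.\<close>

lemma emp_process_moments:
  shows "expectation (emp_process f n) = 0"
    and "1 \<le> n \<Longrightarrow> expectation (\<lambda>\<omega>. (emp_process f n \<omega>)\<^sup>2) = variance (\<lambda>\<omega>. f (Z 1 \<omega>))"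
    and "expectation (\<lambda>\<omega>. emp_process f n \<omega> ^ 4) \<le> 3 * (2 * B) ^ 4"
proof -
  define W where "W j \<omega> = f (Z j \<omega>) - expectation (\<lambda>\<omega>. f (Z 1 \<omega>))" for j \<omega>
  have W: "emp_process f n = (\<lambda>\<omega>. (\<Sum>j=1..n. W j \<omega>) / sqrt (real n))"
    by (simp add: emp_process_def W_def fun_eq_iff)
  have indepW: "indep_vars (\<lambda>_. borel) W {1..n}"
    unfolding W_def
    by (rule indep_vars_compose2[where M' = "\<lambda>_. N"], rule indep_vars_subset[OF indep]) auto
  have boundW: "\<bar>W j \<omega>\<bar> \<le> 2 * B" if "j \<in> {1..n}" for j \<omega>
    unfolding W_def using that by (intro centred_Z(2)) simp
  have intW: "integrable M (W j)" if "1 \<le> j" for j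
    unfolding W_def using integrable_Z[OF that] by simp
  have EW: "expectation (W j) = 0" if "1 \<le> j" for j
    unfolding W_def using that by (rule centred_Z(1))
  have "expectation (\<lambda>\<omega>. \<Sum>j=1..n. W j \<omega>) = (\<Sum>j=1..n. expectation (W j))"
    by (rule Bochner_Integration.integral_sum) (use intW in auto)
  also have "\<dots> = 0" using EW by simp
  finally show "expectation (emp_process f n) = 0" unfolding W by simp
  have varW: "expectation (\<lambda>\<omega>. (W j \<omega>)\<^sup>2) = variance (\<lambda>\<omega>. f (Z 1 \<omega>))" if "1 \<le> j" for j
    unfolding W_def using that by (rule expectation_Z) simp
  have EW': "expectation (W j) = 0" if "j \<in> {1..n}" for j using that by (intro EW) simp
  note mom = centred_indep_sum_moments[OF finite_atLeastAtMost indepW boundW EW']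
  have "expectation (\<lambda>\<omega>. (\<Sum>j=1..n. W j \<omega>)\<^sup>2) = (\<Sum>j=1..n. expectation (\<lambda>\<omega>. (W j \<omega>)\<^sup>2))"
    by (rule mom(1))
  also have "\<dots> = (\<Sum>j=1..n. variance (\<lambda>\<omega>. f (Z 1 \<omega>)))"
    by (rule sum.cong[OF refl], rule varW) simp
  finally have "expectation (\<lambda>\<omega>. (\<Sum>j=1..n. W j \<omega>)\<^sup>2) = real n * variance (\<lambda>\<omega>. f (Z 1 \<omega>))"
    by simp
  then show "expectation (\<lambda>\<omega>. (emp_process f n \<omega>)\<^sup>2) = variance (\<lambda>\<omega>. f (Z 1 \<omega>))" if "1 \<le> n"
    unfolding W power_divide using that by simp
  have "expectation (\<lambda>\<omega>. (\<Sum>j=1..n. W j \<omega>) ^ 4) \<le> 3 * (real n)\<^sup>2 * (2 * B) ^ 4"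
    using mom(2) by simp
  then show "expectation (\<lambda>\<omega>. emp_process f n \<omega> ^ 4) \<le> 3 * (2 * B) ^ 4"
  proof (cases "n = 0")
    case False
    have "sqrt (real n) ^ 4 = (real n)\<^sup>2" 
      using power_mult[of "sqrt (real n)" 2 2] by simp
    then show ?thesis
      unfolding W power_divide using False \<open>expectation _ \<le> _\<close> by (simp add: field_simps)
  qed (simp add: emp_process_def)
qed

text \<open>Chebyshev's inequality, with the variance replaced by the larger second moment. The
  bound does not depend on \<open>n\<close> and is small whenever the index function is small in
  mean square.\<close>

lemma emp_process_tail:
  assumes "1 \<le> n" "0 < \<eta>"
  shows "prob {\<omega> \<in> space M. \<eta> \<le> \<bar>emp_process f n \<omega>\<bar>} \<le> expectation (\<lambda>\<omega>. (f (Z 1 \<omega>))\<^sup>2) / \<eta>\<^sup>2"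
proof -
  have "prob {\<omega> \<in> space M. \<eta> \<le> \<bar>emp_process f n \<omega>\<bar>} \<le> variance (emp_process f n) / \<eta>\<^sup>2"
    using Chebyshev_inequality[OF measurable_emp_process integrable_emp_process_power assms(2)]
    by (simp add: emp_process_moments(1))
  also have "variance (emp_process f n) = variance (\<lambda>\<omega>. f (Z 1 \<omega>))"
    using emp_process_moments(1,2) assms(1) by simp
  also have "\<dots> = expectation (\<lambda>\<omega>. (f (Z 1 \<omega>))\<^sup>2) - (expectation (\<lambda>\<omega>. f (Z 1 \<omega>)))\<^sup>2"
  proof (rule variance_eq)
    show "integrable M (\<lambda>\<omega>. (f (Z 1 \<omega>))\<^sup>2)"
      by (rule integrable_bounded[of _ "B\<^sup>2"]) (use bound in \<open>auto simp: abs_le_square_iff[symmetric] intro: order_trans[OF _ abs_ge_self]\<close>)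
  qed (simp add: integrable_Z)
  finally show ?thesis
    by (rule order_trans) (simp add: divide_right_mono)
qed

end

lemma emp_process_eq_mean:
  assumes "1 \<le> n"
  shows "emp_process f n \<omega>
    = sqrt (real n) * ((1 / real n) * (\<Sum>j=1..n. f (Z j \<omega>)) - expectation (\<lambda>\<omega>. f (Z 1 \<omega>)))"
proof -
  define r where "r = sqrt (real n)"
  have r: "0 < r" "real n = r * r" using assms by (simp_all add: r_def)
  have "emp_process f n \<omega> = ((\<Sum>j=1..n. f (Z j \<omega>)) - real n * expectation (\<lambda>\<omega>. f (Z 1 \<omega>))) / r"
    by (simp add: emp_process_def sum_subtractf r_def)
  also have "\<dots> = r * ((1 / real n) * (\<Sum>j=1..n. f (Z j \<omega>)) - expectation (\<lambda>\<omega>. f (Z 1 \<omega>)))"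
    unfolding r(2) using r(1) by (simp add: field_simps)
  finally show ?thesis by (simp add: r_def)
qed

lemma emp_process_diff:
  assumes "integrable M (\<lambda>\<omega>. f (Z 1 \<omega>))" "integrable M (\<lambda>\<omega>. g (Z 1 \<omega>))"
  shows "emp_process (\<lambda>z. f z - g z) n \<omega> = emp_process f n \<omega> - emp_process g n \<omega>"
  unfolding emp_process_def sum_subtractf using assms
  by (simp add: diff_divide_distrib right_diff_distrib)

lemma emp_process_mult:
  "emp_process (\<lambda>z. c * f z) n \<omega> = c * emp_process f n \<omega>"
  unfolding emp_process_def by (simp add: sum_distrib_left right_diff_distrib)

text \<open>The index function may change with the sample size. Chebyshev's inequality handles the
  random part at level \<open>\<eta> / 2\<close>, and the other half of \<eta> absorbs the
  deterministic drift \<open>c n\<close>. The increments of the empirical processes at local points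
  have this form.\<close>

lemma emp_process_vanishing:
  assumes f: "\<And>n. f n \<in> borel_measurable N" "\<And>n z. \<bar>f n z\<bar> \<le> B"
    and second: "(\<lambda>n. expectation (\<lambda>\<omega>. (f n (Z 1 \<omega>))\<^sup>2)) \<longlonglongrightarrow> 0"
    and c: "c \<longlonglongrightarrow> 0" and \<eta>: "0 < \<eta>"
  shows "(\<lambda>n. prob {\<omega> \<in> space M. \<eta> \<le> \<bar>emp_process (f n) n \<omega> + c n\<bar>}) \<longlonglongrightarrow> 0"
proof (rule tendsto_sandwich[OF _ _ tendsto_const])
  have [measurable]: "random_variable borel (emp_process (f n) n)" for n
    by (rule measurable_emp_process) (use f in auto)
  have "\<forall>\<^sub>F n in sequentially. \<bar>c n\<bar> < \<eta> / 2"
    using tendstoD[OF c, of "\<eta> / 2"] \<eta> by simp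
  with eventually_ge_at_top[of 1]
  show "\<forall>\<^sub>F n in sequentially. prob {\<omega> \<in> space M. \<eta> \<le> \<bar>emp_process (f n) n \<omega> + c n\<bar>}
      \<le> expectation (\<lambda>\<omega>. (f n (Z 1 \<omega>))\<^sup>2) / (\<eta> / 2)\<^sup>2"
  proof eventually_elim
    case (elim n)
    have "prob {\<omega> \<in> space M. \<eta> \<le> \<bar>emp_process (f n) n \<omega> + c n\<bar>}
        \<le> prob {\<omega> \<in> space M. \<eta> / 2 \<le> \<bar>emp_process (f n) n \<omega>\<bar>}"
      using elim(2) by (intro finite_measure_mono) auto
    also have "\<dots> \<le> expectation (\<lambda>\<omega>. (f n (Z 1 \<omega>))\<^sup>2) / (\<eta> / 2)\<^sup>2"
      by (rule emp_process_tail[OF f(1) f(2) elim(1)]) (use \<eta> in simp)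
    finally show ?case .
  qed
  show "(\<lambda>n. expectation (\<lambda>\<omega>. (f n (Z 1 \<omega>))\<^sup>2) / (\<eta> / 2)\<^sup>2) \<longlonglongrightarrow> 0"
    by (rule tendsto_divide_zero[OF second])
qed simp

end

section \<open>Empirical distribution functions and the empirical copula\<close>

lemma emp_cdf_mono: "s \<le> t \<Longrightarrow> emp_cdf n x s \<le> emp_cdf n x t"
  unfolding emp_cdf_def by (intro mult_left_mono sum_mono) auto

text \<open>Monotonicity of the empirical distribution function transfers a bound at
  \<open>s\<close> to the normalised ranks of all observations up to \<open>s\<close>. The next
  lemma is the converse, where the strict inequality excludes observations beyond
  \<open>s\<close>.\<close>

lemma emp_cdf_le_obs: "emp_cdf n x s \<le> u \<Longrightarrow> x j \<le> s \<Longrightarrow> emp_cdf n x (x j) \<le> u"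
  using emp_cdf_mono[of "x j" s n x] by simp

lemma obs_le_emp_cdf: "u < emp_cdf n x s \<Longrightarrow> emp_cdf n x (x j) \<le> u \<Longrightarrow> x j \<le> s"
  using emp_cdf_mono[of s "x j" n x] by (rule_tac ccontr) simp

text \<open>The function \<open>H\<close> of the introduction. No ranks enter, so its value at a
  fixed point is a mean of i.i.d. indicators.\<close>

definition emp_joint :: "nat \<Rightarrow> (nat \<Rightarrow> real) \<Rightarrow> (nat \<Rightarrow> real) \<Rightarrow> real \<Rightarrow> real \<Rightarrow> real" where
  "emp_joint n x y s t = (1 / real n) * (\<Sum>j=1..n. of_bool (x j \<le> s) * of_bool (y j \<le> t))"

text \<open>The inequality holds summand by summand: each observation counted on the left has both
  normalised ranks within the thresholds. The reverse comparison follows in the same way from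
  \<open>obs_le_emp_cdf\<close>.\<close>

lemma emp_joint_le_emp_copula:
  assumes "emp_cdf n x s \<le> u" "emp_cdf n y t \<le> v"
  shows "emp_joint n x y s t \<le> emp_copula n x y u v"
  unfolding emp_joint_def emp_copula_def
  by (intro mult_left_mono sum_mono mult_mono)
    (auto intro: emp_cdf_le_obs[OF assms(1)] emp_cdf_le_obs[OF assms(2)])

lemma emp_copula_le_emp_joint:
  assumes "u < emp_cdf n x s" "v < emp_cdf n y t"
  shows "emp_copula n x y u v \<le> emp_joint n x y s t"
  unfolding emp_joint_def emp_copula_def
  by (intro mult_left_mono sum_mono mult_mono)
    (auto intro: obs_le_emp_cdf[OF assms(1)] obs_le_emp_cdf[OF assms(2)])

section \<open>Ranks in samples without ties\<close>

lemma emp_cdf_card: "emp_cdf n x t = real (card {j\<in>{1..n}. x j \<le> t}) / real n"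
  unfolding emp_cdf_def by (simp add: of_bool_def sum.If_cases Int_def)

text \<open>A larger observation has a strictly larger rank, so distinct observations have distinct
  ranks; an injective map of a finite set into itself is onto.\<close>

lemma rank_bij:
  fixes x :: "nat \<Rightarrow> real"
  assumes "inj_on x {1..n}"
  shows "bij_betw (\<lambda>j. card {l\<in>{1..n}. x l \<le> x j}) {1..n} {1..n}"
proof -
  let ?r = "\<lambda>j. card {l\<in>{1..n}. x l \<le> x j}"
  have less: "?r j < ?r l" if "j \<in> {1..n}" "l \<in> {1..n}" "x j < x l" for j l
  proof (rule psubset_card_mono)
    have "l \<in> {m\<in>{1..n}. x m \<le> x l}" "l \<notin> {m\<in>{1..n}. x m \<le> x j}" using that by auto
    moreover have "{m\<in>{1..n}. x m \<le> x j} \<subseteq> {m\<in>{1..n}. x m \<le> x l}" using that by auto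
    ultimately show "{m\<in>{1..n}. x m \<le> x j} \<subset> {m\<in>{1..n}. x m \<le> x l}" by blast
  qed simp
  have "inj_on ?r {1..n}"
  proof (rule inj_onI)
    fix j l assume jl: "j \<in> {1..n}" "l \<in> {1..n}" "?r j = ?r l"
    then have "\<not> x j < x l" "\<not> x l < x j" using less[of j l] less[of l j] by auto
    then have "x j = x l" by simp
    with jl assms show "j = l" by (auto dest: inj_onD)
  qed
  moreover have "?r ` {1..n} \<subseteq> {1..n}"
  proof safe
    fix j assume j: "j \<in> {1..n}"
    have "?r j \<le> card {1..n}" by (rule card_mono) auto
    moreover have "?r j > 0" using j by (auto simp: card_gt_0_iff)
    ultimately show "?r j \<in> {1..n}" by simp
  qed
  ultimately show ?thesis
    unfolding bij_betw_def by (simp add: endo_inj_surj)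
qed

text \<open>Without ties every rank from 1 to \<open>n\<close> occurs exactly once. Hence precisely
  \<open>\<lfloor>u * n\<rfloor>\<close> observations have normalised rank at most \<open>u\<close>,
  and rounding costs less than one observation.\<close>

lemma card_emp_cdf_le:
  assumes inj: "inj_on x {1..n}" and n: "n \<ge> 1" and u: "0 \<le> u" "u < 1"
  shows "\<bar>real (card {j\<in>{1..n}. emp_cdf n x (x j) \<le> u}) / real n - u\<bar> \<le> 1 / real n"
proof -
  define k where "k = nat \<lfloor>u * real n\<rfloor>"
  have k: "real k \<le> u * real n" "u * real n < real k + 1"
    using u by (auto simp: k_def)
  have kn: "k \<le> n" 
  proof -
    have "u * real n \<le> 1 * real n" using u by (intro mult_right_mono) auto
    then show ?thesis using k(1) by linarith
  qed
  let ?r = "\<lambda>j. card {l\<in>{1..n}. x l \<le> x j}"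
  have eq: "{j\<in>{1..n}. emp_cdf n x (x j) \<le> u} = {j\<in>{1..n}. ?r j \<le> k}"
  proof -
    have "emp_cdf n x (x j) \<le> u \<longleftrightarrow> ?r j \<le> k" for j
    proof -
      have "emp_cdf n x (x j) \<le> u \<longleftrightarrow> real (?r j) \<le> u * real n"
        using n by (simp add: emp_cdf_card field_simps)
      also have "\<dots> \<longleftrightarrow> ?r j \<le> k" using k by linarith
      finally show ?thesis .
    qed
    then show ?thesis by simp
  qed
  have "bij_betw ?r {j\<in>{1..n}. ?r j \<le> k} {1..k}"
  proof -
    have b: "inj_on ?r {1..n}" "?r ` {1..n} = {1..n}"
      using rank_bij[OF inj] by (auto simp: bij_betw_def)
    have "?r ` {j\<in>{1..n}. ?r j \<le> k} = {1..k}"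
    proof -
      have "?r ` {j\<in>{1..n}. ?r j \<le> k} = ?r ` {1..n} \<inter> {..k}" by auto
      also have "\<dots> = {1..k}" unfolding b(2) using kn by auto
      finally show ?thesis .
    qed
    moreover have "inj_on ?r {j\<in>{1..n}. ?r j \<le> k}" by (rule inj_on_subset[OF b(1)]) blast
    ultimately show ?thesis unfolding bij_betw_def by blast
  qed
  then have "card {j\<in>{1..n}. ?r j \<le> k} = k" using bij_betw_same_card by fastforce
  then have "real (card {j\<in>{1..n}. emp_cdf n x (x j) \<le> u}) = real k" using eq by simp
  moreover have "\<bar>real k / real n - u\<bar> \<le> 1 / real n"
  proof -
    have "real k / real n - u = (real k - u * real n) / real n" using n by (simp add: field_simps)
    then show ?thesis using k n by (simp add: abs_divide divide_right_mono)
  qed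
  ultimately show ?thesis by simp
qed

text \<open>For nested sets the difference of the indicators has the same sign at every index, so
  the absolute value can be moved outside the sum.\<close>

lemma sum_abs_diff_nested:
  assumes "finite I" "A \<subseteq> B \<or> B \<subseteq> A"
  shows "(\<Sum>j\<in>I. \<bar>of_bool (j \<in> A) - of_bool (j \<in> B) :: real\<bar>)
    = \<bar>(\<Sum>j\<in>I. of_bool (j \<in> A)) - (\<Sum>j\<in>I. of_bool (j \<in> B))\<bar>"
  using assms(2)
proof
  assume "A \<subseteq> B"
  then have eq: "\<bar>of_bool (j \<in> A) - of_bool (j \<in> B) :: real\<bar> = of_bool (j \<in> B) - of_bool (j \<in> A)"
    and le: "(of_bool (j \<in> A) :: real) \<le> of_bool (j \<in> B)" for j by auto
  have "(\<Sum>j\<in>I. of_bool (j \<in> A) :: real) \<le> (\<Sum>j\<in>I. of_bool (j \<in> B))"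
    by (rule sum_mono) (rule le)
  then show ?thesis unfolding eq sum_subtractf by simp
next
  assume "B \<subseteq> A"
  then have eq: "\<bar>of_bool (j \<in> A) - of_bool (j \<in> B) :: real\<bar> = of_bool (j \<in> A) - of_bool (j \<in> B)"
    and le: "(of_bool (j \<in> B) :: real) \<le> of_bool (j \<in> A)" for j by auto
  have "(\<Sum>j\<in>I. of_bool (j \<in> B) :: real) \<le> (\<Sum>j\<in>I. of_bool (j \<in> A))"
    by (rule sum_mono) (rule le)
  then show ?thesis unfolding eq sum_subtractf by simp
qed

text \<open>Both conditions select initial segments in the order of the observations, so the two
  index sets are nested and the left side is a difference of two counts. One count is
  \<open>n * emp_cdf n x s\<close>; the other is \<open>n * u\<close> up to one observation.\<close>

lemma mean_abs_diff_rank_indicator: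
  assumes inj: "inj_on x {1..n}" and n: "n \<ge> 1" and u: "0 \<le> u" "u < 1"
  shows "(1 / real n) * (\<Sum>j=1..n. \<bar>of_bool (emp_cdf n x (x j) \<le> u) - of_bool (x j \<le> s)\<bar>)
    \<le> \<bar>u - emp_cdf n x s\<bar> + 1 / real n"
proof -
  let ?A = "{j. emp_cdf n x (x j) \<le> u}" and ?B = "{j. x j \<le> s}"
  have "?A \<subseteq> ?B \<or> ?B \<subseteq> ?A"
    using emp_cdf_le_obs[of n x s u] obs_le_emp_cdf[of u n x s] by (cases "emp_cdf n x s \<le> u") auto
  from sum_abs_diff_nested[OF _ this, of "{1..n}"]
  have "(\<Sum>j=1..n. \<bar>of_bool (emp_cdf n x (x j) \<le> u) - of_bool (x j \<le> s) :: real\<bar>)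
    = \<bar>(\<Sum>j=1..n. of_bool (emp_cdf n x (x j) \<le> u)) - (\<Sum>j=1..n. of_bool (x j \<le> s))\<bar>"
    by simp
  also have "(\<Sum>j=1..n. of_bool (x j \<le> s)) = real n * emp_cdf n x s"
    using n by (simp add: emp_cdf_def)
  also have "(\<Sum>j=1..n. of_bool (emp_cdf n x (x j) \<le> u)) = real (card {j\<in>{1..n}. emp_cdf n x (x j) \<le> u})"
    by (simp add: of_bool_def sum.If_cases Int_def)
  finally have "(1 / real n) * (\<Sum>j=1..n. \<bar>of_bool (emp_cdf n x (x j) \<le> u) - of_bool (x j \<le> s)\<bar>)
    = \<bar>real (card {j\<in>{1..n}. emp_cdf n x (x j) \<le> u}) - real n * emp_cdf n x s\<bar> / real n"
    by (simp only: mult_1 times_divide_eq_left)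
  also have "\<dots> = \<bar>real (card {j\<in>{1..n}. emp_cdf n x (x j) \<le> u}) / real n - emp_cdf n x s\<bar>"
    using n by (subst abs_div_pos) (simp_all add: diff_divide_distrib)
  also have "\<dots> \<le> \<bar>u - emp_cdf n x s\<bar> + 1 / real n"
    using card_emp_cdf_le[OF assms] by linarith
  finally show ?thesis .
qed

text \<open>A product of indicators changes by at most the sum of the changes of its factors, which
  reduces the claim to the two margins. This pathwise bound is what controls the fourth moment of
  the linearisation error.\<close>

lemma emp_copula_emp_joint_bound:
  assumes "inj_on x {1..n}" "inj_on y {1..n}" and n: "n \<ge> 1" and "0 \<le> u" "u < 1" "0 \<le> v" "v < 1"
  shows "\<bar>emp_copula n x y u v - emp_joint n x y s t\<bar>
    \<le> \<bar>u - emp_cdf n x s\<bar> + \<bar>v - emp_cdf n y t\<bar> + 2 / real n"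
proof -
  let ?a = "\<lambda>j. of_bool (emp_cdf n x (x j) \<le> u) :: real" and ?b = "\<lambda>j. of_bool (emp_cdf n y (y j) \<le> v) :: real"
  let ?c = "\<lambda>j. of_bool (x j \<le> s) :: real" and ?d = "\<lambda>j. of_bool (y j \<le> t) :: real"
  have "\<bar>emp_copula n x y u v - emp_joint n x y s t\<bar> = (1 / real n) * \<bar>\<Sum>j=1..n. ?a j * ?b j - ?c j * ?d j\<bar>"
    unfolding emp_copula_def emp_joint_def sum_subtractf right_diff_distrib[symmetric] abs_mult by simp
  also have "\<dots> \<le> (1 / real n) * (\<Sum>j=1..n. \<bar>?a j - ?c j\<bar> + \<bar>?b j - ?d j\<bar>)"
  proof (intro mult_left_mono order_trans[OF sum_abs] sum_mono)
    have "\<bar>of_bool a * of_bool b - of_bool c * of_bool d :: real\<bar>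
        \<le> \<bar>of_bool a - of_bool c\<bar> + \<bar>of_bool b - of_bool d\<bar>" for a b c d
      by (cases a; cases b; cases c; cases d) simp_all
    then show "\<bar>?a j * ?b j - ?c j * ?d j\<bar> \<le> \<bar>?a j - ?c j\<bar> + \<bar>?b j - ?d j\<bar>" for j .
  qed simp
  also have "\<dots> = (1 / real n) * (\<Sum>j=1..n. \<bar>?a j - ?c j\<bar>) + (1 / real n) * (\<Sum>j=1..n. \<bar>?b j - ?d j\<bar>)"
    by (simp only: sum.distrib distrib_left)
  finally show ?thesis
    using mean_abs_diff_rank_indicator[OF assms(1) n assms(4,5), of s]
      mean_abs_diff_rank_indicator[OF assms(2) n assms(6,7), of t]
    by linarith
qed

lemma abs_emp_le: "\<bar>emp_joint n x y s t\<bar> \<le> 1" "\<bar>emp_copula n x y u v\<bar> \<le> 1"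
proof -
  have "\<bar>(1 / real n) * (\<Sum>j=1..n. of_bool (P j) * of_bool (Q j))\<bar> \<le> 1" for P Q
  proof -
    have "(\<Sum>j=1..n. of_bool (P j) * of_bool (Q j) :: real) \<le> real (card {1..n}) * 1"
      by (rule sum_bounded_above) simp
    moreover have "0 \<le> (\<Sum>j=1..n. of_bool (P j) * of_bool (Q j) :: real)" by (rule sum_nonneg) simp
    ultimately show ?thesis by (cases "n = 0") (simp_all add: field_simps)
  qed
  note bound = this
  show "\<bar>emp_joint n x y s t\<bar> \<le> 1" unfolding emp_joint_def by (rule bound)
  show "\<bar>emp_copula n x y u v\<bar> \<le> 1" unfolding emp_copula_def by (rule bound)
qed

text \<open>The grid indices \<open>i\<close> and \<open>i'\<close> chosen below satisfy \<open>emp_cdf n x (sX i) \<le> \<alpha> < emp_cdf n x (sX i')\<close>,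
  so the empirical copula is caught between two values of \<open>emp_joint\<close> at grid points; no control of
  the random quantile itself is needed.\<close>

lemma emp_copula_local_sandwich:
  fixes x y :: "nat \<Rightarrow> real" and sX sY :: "int \<Rightarrow> real" and p q r \<eta> R \<alpha> a b :: real
  assumes r: "0 < r" and \<eta>: "0 < \<eta>" and N: "R / \<eta> + 2 \<le> of_int N"
    and X: "\<bar>r * (emp_cdf n x a - \<alpha>)\<bar> < R" and Y: "\<bar>r * (emp_cdf n y b - \<alpha>)\<bar> < R"
    and gridX: "\<And>i. i \<in> {-N..N} \<Longrightarrow> \<bar>r * (emp_cdf n x (sX i) - emp_cdf n x a) - of_int i * \<eta>\<bar> < \<eta>"
    and gridY: "\<And>i. i \<in> {-N..N} \<Longrightarrow> \<bar>r * (emp_cdf n y (sY i) - emp_cdf n y b) - of_int i * \<eta>\<bar> < \<eta>"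
    and gridXY: "\<And>i l. i \<in> {-N..N} \<Longrightarrow> l \<in> {-N..N} \<Longrightarrow>
      \<bar>r * (emp_joint n x y (sX i) (sY l) - emp_joint n x y a b) - (p * (of_int i * \<eta>) + q * (of_int l * \<eta>))\<bar> < \<eta>"
  shows "\<bar>r * (emp_copula n x y \<alpha> \<alpha> - emp_joint n x y a b)
      + p * (r * (emp_cdf n x a - \<alpha>)) + q * (r * (emp_cdf n y b - \<alpha>))\<bar> \<le> (2 * \<bar>p\<bar> + 2 * \<bar>q\<bar> + 1) * \<eta>"
proof -
  \<comment> \<open>Each margin is treated separately: some grid point lies below the \<alpha>-level
    of the empirical distribution function and some lies above it, and both grid offsets are within
    \<open>2 * \<eta>\<close> of the negative scaled deviation at \<open>c\<close>.\<close>
  have bracket: "\<exists>i i'. i \<in> {-N..N} \<and> i' \<in> {-N..N} \<and> emp_cdf n w (s i) \<le> \<alpha> \<and> \<alpha> < emp_cdf n w (s i')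
      \<and> \<bar>of_int i * \<eta> + r * (emp_cdf n w c - \<alpha>)\<bar> \<le> 2 * \<eta> \<and> \<bar>of_int i' * \<eta> + r * (emp_cdf n w c - \<alpha>)\<bar> \<le> 2 * \<eta>"
    if c: "\<bar>r * (emp_cdf n w c - \<alpha>)\<bar> < R"
      and grid: "\<And>i. i \<in> {-N..N} \<Longrightarrow> \<bar>r * (emp_cdf n w (s i) - emp_cdf n w c) - of_int i * \<eta>\<bar> < \<eta>"
    for w s c
  proof -
    define g where "g = r * (\<alpha> - emp_cdf n w c)"
    \<comment> \<open>The grid cell of the scaled gap \<open>g\<close>. Grid values are known only
      up to an error below \<eta>, so the index \<open>k - 1\<close> is needed to stay below the
      level and \<open>k + 2\<close> to exceed it.\<close>
    define k where "k = \<lfloor>g / \<eta>\<rfloor>"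
    have k: "of_int k * \<eta> \<le> g" "g < of_int k * \<eta> + \<eta>"
    proof -
      have "of_int k \<le> g / \<eta>" "g / \<eta> < of_int k + 1" unfolding k_def by linarith+
      then show "of_int k * \<eta> \<le> g" "g < of_int k * \<eta> + \<eta>" using \<eta> by (simp_all add: field_simps)
    qed
    have "\<bar>g / \<eta>\<bar> < R / \<eta>" using c \<eta> unfolding g_def
      by (simp add: abs_divide divide_strict_right_mono abs_mult abs_minus_commute)
    \<comment> \<open>The margin 2 in the hypothesis on \<open>N\<close> keeps both shifted indices
      inside the grid.\<close>
    then have "- real_of_int N \<le> of_int k - 1" "of_int k + 2 \<le> real_of_int N"
      using N unfolding k_def by linarith+
    then have kN: "k - 1 \<in> {-N..N}" "k + 2 \<in> {-N..N}" by auto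
    have "r * (emp_cdf n w (s (k - 1)) - \<alpha>) < 0"
    proof -
      have "r * (emp_cdf n w (s (k - 1)) - emp_cdf n w c) < of_int k * \<eta>"
        using grid[OF kN(1)] by (simp add: algebra_simps)
      with k(1) show ?thesis by (simp add: g_def algebra_simps)
    qed
    moreover have "0 < r * (emp_cdf n w (s (k + 2)) - \<alpha>)"
    proof -
      have "of_int k * \<eta> + \<eta> < r * (emp_cdf n w (s (k + 2)) - emp_cdf n w c)"
        using grid[OF kN(2)] by (simp add: algebra_simps)
      with k(2) show ?thesis by (simp add: g_def algebra_simps)
    qed
    ultimately have "emp_cdf n w (s (k - 1)) \<le> \<alpha>" "\<alpha> < emp_cdf n w (s (k + 2))"
      using r by (auto simp: mult_less_0_iff zero_less_mult_iff)
    moreover have "\<bar>of_int (k - 1) * \<eta> + r * (emp_cdf n w c - \<alpha>)\<bar> \<le> 2 * \<eta>"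
      "\<bar>of_int (k + 2) * \<eta> + r * (emp_cdf n w c - \<alpha>)\<bar> \<le> 2 * \<eta>"
      using k \<eta> by (auto simp: g_def abs_le_iff algebra_simps)
    ultimately show ?thesis using kN by blast
  qed
  obtain i i' where i: "i \<in> {-N..N}" "i' \<in> {-N..N}" "emp_cdf n x (sX i) \<le> \<alpha>" "\<alpha> < emp_cdf n x (sX i')"
    "\<bar>of_int i * \<eta> + r * (emp_cdf n x a - \<alpha>)\<bar> \<le> 2 * \<eta>" "\<bar>of_int i' * \<eta> + r * (emp_cdf n x a - \<alpha>)\<bar> \<le> 2 * \<eta>"
    using bracket[OF X gridX] by blast
  obtain l l' where l: "l \<in> {-N..N}" "l' \<in> {-N..N}" "emp_cdf n y (sY l) \<le> \<alpha>" "\<alpha> < emp_cdf n y (sY l')"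
    "\<bar>of_int l * \<eta> + r * (emp_cdf n y b - \<alpha>)\<bar> \<le> 2 * \<eta>" "\<bar>of_int l' * \<eta> + r * (emp_cdf n y b - \<alpha>)\<bar> \<le> 2 * \<eta>"
    using bracket[OF Y gridY] by blast
  have scaled: "\<bar>c * u + c * v\<bar> \<le> 2 * \<bar>c\<bar> * \<eta>" if "\<bar>u + v\<bar> \<le> 2 * \<eta>" for c u v
  proof -
    have "\<bar>c * u + c * v\<bar> = \<bar>c\<bar> * \<bar>u + v\<bar>" by (simp add: abs_mult flip: distrib_left)
    also have "\<dots> \<le> \<bar>c\<bar> * (2 * \<eta>)" using that by (intro mult_left_mono) auto
    finally show ?thesis by simp
  qed
  have "r * (emp_joint n x y (sX i) (sY l) - emp_joint n x y a b) \<le> r * (emp_copula n x y \<alpha> \<alpha> - emp_joint n x y a b)"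
    using r emp_joint_le_emp_copula[OF i(3) l(3)] by (intro mult_left_mono) auto
  moreover have "r * (emp_copula n x y \<alpha> \<alpha> - emp_joint n x y a b) \<le> r * (emp_joint n x y (sX i') (sY l') - emp_joint n x y a b)"
    using r emp_copula_le_emp_joint[OF i(4) l(4)] by (intro mult_left_mono) auto
  \<comment> \<open>At the lower and upper grid points \<open>gridXY\<close> replaces the increment
    of \<open>emp_joint\<close> by its linear form at cost \<eta>. By \<open>scaled\<close> the
    linear form cancels against the marginal deviations at cost
    \<open>2 * \<bar>p\<bar> * \<eta> + 2 * \<bar>q\<bar> * \<eta>\<close>, whatever the signs of
    \<open>p\<close> and \<open>q\<close>.\<close>
  ultimately show ?thesis
    using gridXY[OF i(1) l(1)] gridXY[OF i(2) l(2)]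
      scaled[OF i(5), of p] scaled[OF i(6), of p] scaled[OF l(5), of q] scaled[OF l(6), of q]
    unfolding distrib_right mult_1 abs_le_iff abs_less_iff by linarith
qed

section \<open>Copulas and continuous marginals\<close>

text \<open>Continuous partial derivatives give total differentiability at an interior point; the
  chain rule along a straight line through it does the rest.\<close>

lemma continuous_partials_DERIV_line:
  assumes C: "continuous_partials C" and uv: "u \<in> {0<..<1}" "v \<in> {0<..<1}"
  shows "((\<lambda>\<tau>. C (u + s * \<tau>) (v + t * \<tau>)) has_real_derivative h1 C u v * s + h2 C u v * t) (at 0)"
proof -
  let ?I = "{0<..<1::real}"
  have d1: "((\<lambda>x. C x v) has_real_derivative h1 C u v) (at u)"
    using C uv unfolding continuous_partials_def h1_def
    by (simp add: DERIV_deriv_iff_field_differentiable)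
  have d2: "((\<lambda>y. C x y) has_real_derivative h2 C x y) (at y)" if "x \<in> ?I" "y \<in> ?I" for x y
    using C that unfolding continuous_partials_def h2_def
    by (simp add: DERIV_deriv_iff_field_differentiable)
  have "continuous (at (u, v) within ?I \<times> ?I) (\<lambda>(x, y). h2 C x y)"
    using C uv unfolding continuous_partials_def continuous_on_eq_continuous_within by auto
  \<comment> \<open>The rule \<open>has_derivative_partialsI\<close> asks for the second partial
    derivative as a continuous family of bounded linear maps.\<close>
  then have cont: "continuous (at (u, v) within ?I \<times> ?I) (\<lambda>(x, y). blinfun_mult_right (h2 C x y))"
    unfolding case_prod_beta by (rule bounded_linear.continuous[OF bounded_linear_blinfun_mult_right])
  have "((\<lambda>(x, y). C x y) has_derivative (\<lambda>(tx, ty). h1 C u v * tx + blinfun_mult_right (h2 C u v) ty))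
      (at (u, v) within ?I \<times> ?I)"
  proof (rule has_derivative_partialsI)
    show "((\<lambda>x. C x v) has_derivative (*) (h1 C u v)) (at u within ?I)"
      using has_field_derivative_at_within[OF d1] by (simp add: has_field_derivative_def)
    show "((\<lambda>y. C x y) has_derivative blinfun_apply (blinfun_mult_right (h2 C x y))) (at y within ?I)"
      if "x \<in> ?I" "y \<in> ?I" for x y
      using has_field_derivative_at_within[OF d2[OF that]] by (simp add: has_field_derivative_def)
  qed (use cont uv in auto)
  moreover have "at (u, v) within ?I \<times> ?I = at (u, v)"
    using uv by (intro at_within_open open_Times) auto
  ultimately have der: "((\<lambda>z. C (fst z) (snd z)) has_derivative (\<lambda>z. h1 C u v * fst z + h2 C u v * snd z)) (at (u, v))"
    by (simp add: case_prod_unfold)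
  have line: "((\<lambda>\<tau>. (u + s * \<tau>, v + t * \<tau>)) has_derivative (\<lambda>h. (s * h, t * h))) (at 0)"
    by (auto intro!: derivative_eq_intros)
  have der0: "((\<lambda>z. C (fst z) (snd z)) has_derivative (\<lambda>z. h1 C u v * fst z + h2 C u v * snd z))
      (at (u + s * 0, v + t * 0))"
    using der by simp
  have "((\<lambda>\<tau>. C (u + s * \<tau>) (v + t * \<tau>)) has_derivative (\<lambda>h. h1 C u v * (s * h) + h2 C u v * (t * h))) (at 0)"
    using has_derivative_compose[OF line der0] by (simp only: fst_conv snd_conv)
  then show ?thesis
    unfolding has_field_derivative_def by (rule has_derivative_eq_rhs) (simp add: fun_eq_iff algebra_simps)
qed

lemma filterlim_inverse_sqrt: "filterlim (\<lambda>n. 1 / sqrt (real n)) (at 0) sequentially"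
proof -
  have "(\<lambda>n. 1 / sqrt (real n)) \<longlonglongrightarrow> 0"
    by (rule tendsto_divide_0[OF tendsto_const])
      (rule filterlim_at_top_imp_at_infinity[OF filterlim_compose[OF sqrt_at_top filterlim_real_sequentially]])
  moreover have "\<forall>\<^sub>F n in sequentially. 1 / sqrt (real n) \<noteq> 0"
    using eventually_gt_at_top[of 0] by eventually_elim simp
  ultimately show ?thesis by (simp add: filterlim_at)
qed

text \<open>The difference quotient along a line, evaluated at step \<open>1 / sqrt n\<close>. It
  supplies the drift of the joint empirical process between local points.\<close>

lemma continuous_partials_increment_tendsto:
  assumes "continuous_partials C" "u \<in> {0<..<1}" "v \<in> {0<..<1}"
  shows "(\<lambda>n. sqrt (real n) * (C (u + s / sqrt (real n)) (v + t / sqrt (real n)) - C u v))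
    \<longlonglongrightarrow> h1 C u v * s + h2 C u v * t"
proof -
  have "((\<lambda>\<tau>. (C (u + s * \<tau>) (v + t * \<tau>) - C u v) / \<tau>) \<longlongrightarrow> h1 C u v * s + h2 C u v * t) (at 0)"
    using continuous_partials_DERIV_line[OF assms, of s t] by (simp add: DERIV_def)
  from filterlim_compose[OF this filterlim_inverse_sqrt] show ?thesis
    by (simp add: field_simps)
qed

text \<open>With \<open>C 1 1 = 1\<close>, subtracting the tail quotient from 2 gives exactly the
  left difference quotient of the diagonal. The assumed tail limit thus also guarantees that the
  limit behind \<open>left_deriv\<close> exists.\<close>

lemma left_deriv_diagonal_copula:
  assumes "copula C" "has_upper_tail_dependence C l"
  shows "left_deriv (diagonal C) 1 = 2 - l"
proof -
  have C1: "C 1 1 = 1" using assms(1) by (auto simp: copula_def)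
  have "((\<lambda>u. 2 - (1 - 2 * u + C u u) / (1 - u)) \<longlongrightarrow> 2 - l) (at_left 1)"
    using assms(2) unfolding has_upper_tail_dependence_def by (intro tendsto_intros)
  moreover have "\<forall>\<^sub>F u in at_left (1::real). 2 - (1 - 2 * u + C u u) / (1 - u)
      = (diagonal C 1 - diagonal C u) / (1 - u)"
    unfolding eventually_at_left_field
    by (intro exI[of _ 0]) (auto simp: diagonal_def C1 field_simps)
  ultimately have "((\<lambda>u. (diagonal C 1 - diagonal C u) / (1 - u)) \<longlongrightarrow> 2 - l) (at_left 1)"
    by (rule Lim_transform_eventually)
  then show ?thesis
    unfolding left_deriv_def by (intro tendsto_Lim) simp_all
qed

text \<open>The joint law of two independent variables is a product measure, and a law with
  continuous distribution function has no atoms. Every section of the diagonal is then null, hence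
  so is the diagonal; finitely many pairs of indices remain to be combined.\<close>

lemma (in prob_space) AE_inj_on_of_continuous_cdf:
  fixes X :: "nat \<Rightarrow> 'a \<Rightarrow> real"
  assumes indep: "indep_vars (\<lambda>_. borel) X I" and "finite I"
    and cont: "\<And>j x. j \<in> I \<Longrightarrow> isCont (cdf (distr M borel (X j))) x"
  shows "AE \<omega> in M. inj_on (\<lambda>j. X j \<omega>) I"
proof -
  have rv: "random_variable borel (X j)" if "j \<in> I" for j
    using indep that by (auto simp: indep_vars_def)
  have ne: "AE \<omega> in M. X j \<omega> \<noteq> X l \<omega>" if jl: "j \<in> I" "l \<in> I" "j \<noteq> l" for j l
  proof -
    note [measurable] = rv[OF jl(1)] rv[OF jl(2)]
    interpret J: real_distribution "distr M borel (X j)" by (rule real_distribution_distr) fact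
    interpret L: real_distribution "distr M borel (X l)" by (rule real_distribution_distr) fact
    interpret P: pair_prob_space "distr M borel (X j)" "distr M borel (X l)" ..
    have "indep_var borel ((\<lambda>f. f j) \<circ> (\<lambda>\<omega>. restrict (\<lambda>i. X i \<omega>) {j}))
        borel ((\<lambda>f. f l) \<circ> (\<lambda>\<omega>. restrict (\<lambda>i. X i \<omega>) {l}))"
      by (rule indep_var_compose[OF indep_var_restrict[OF indep]]) (use jl in auto)
    then have "indep_var borel (X j) borel (X l)" by (simp add: comp_def)
    then have eq: "distr M borel (X j) \<Otimes>\<^sub>M distr M borel (X l)
        = distr M (borel \<Otimes>\<^sub>M borel) (\<lambda>\<omega>. (X j \<omega>, X l \<omega>))"
      unfolding indep_var_distribution_eq by simp
    have diag: "{z \<in> space (borel \<Otimes>\<^sub>M borel). fst z \<noteq> (snd z :: real)} \<in> sets (borel \<Otimes>\<^sub>M borel)"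
      by measurable
    have "AE y in distr M borel (X l). x \<noteq> y" for x
    proof (rule AE_I)
      have "L.prob {x} = 0" using cont[OF jl(2), of x] L.isCont_cdf by simp
      then show "emeasure (distr M borel (X l)) {x} = 0" by (simp add: L.emeasure_eq_measure)
    qed auto
    then have "AE z in distr M borel (X j) \<Otimes>\<^sub>M distr M borel (X l). fst z \<noteq> snd z"
      using diag by (intro P.AE_pair_measure) (auto simp: space_pair_measure)
    then show ?thesis unfolding eq using diag by (subst (asm) AE_distr_iff) auto
  qed
  have "AE \<omega> in M. \<forall>j\<in>I. \<forall>l\<in>I. j \<noteq> l \<longrightarrow> X j \<omega> \<noteq> X l \<omega>"
    using ne \<open>finite I\<close> by (intro AE_finite_allI) (auto intro!: AE_impI)
  then show ?thesis by (rule AE_mp) (auto simp: inj_on_def)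
qed

lemma (in real_distribution) cdf_surj:
  assumes cont: "\<And>x. isCont (cdf M) x" and u: "0 < u" "u < 1"
  shows "\<exists>x. cdf M x = u"
proof -
  have "\<forall>\<^sub>F x in at_bot. cdf M x < u" using order_tendstoD(2)[OF cdf_lim_at_bot u(1)] .
  then obtain a where a: "cdf M a < u" by (auto simp: eventually_at_bot_linorder)
  have "\<forall>\<^sub>F x in at_top. u < cdf M x" using order_tendstoD(1)[OF cdf_lim_at_top_prob u(2)] .
  then obtain b where b: "u < cdf M b" by (auto simp: eventually_at_top_linorder)
  have "a \<le> b" using a b cdf_nondecreasing[of b a] by linarith
  then show ?thesis
    using IVT[of "cdf M" a u b] a b cont by force
qed

section \<open>Linearisation of the empirical copula\<close>

locale copula_sample = prob_space M for M :: "'a measure" +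
  fixes X Y :: "nat \<Rightarrow> 'a \<Rightarrow> real" and C :: "real \<Rightarrow> real \<Rightarrow> real" and \<alpha> :: real
  assumes iid: "iid_pairs M X Y"
    and contX: "continuous_on UNIV (cdf (distr M borel (X 1)))"
    and contY: "continuous_on UNIV (cdf (distr M borel (Y 1)))"
    and cop: "copula_of M (X 1) (Y 1) C"
    and partials: "continuous_partials C"
    and \<alpha>: "0 < \<alpha>" "\<alpha> < 1"
begin

abbreviation Z :: "nat \<Rightarrow> 'a \<Rightarrow> real \<times> real" where "Z j \<omega> \<equiv> (X j \<omega>, Y j \<omega>)"
abbreviation "F \<equiv> cdf (distr M borel (X 1))"
abbreviation "G \<equiv> cdf (distr M borel (Y 1))"

sublocale iid_sample M "borel :: (real \<times> real) measure" Z
proof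
  show "indep_vars (\<lambda>_. borel) Z {1..}" using iid unfolding iid_pairs_def by (rule conjunct1)
  show "distr M borel (Z j) = distr M borel (Z 1)" if "1 \<le> j" for j
    using iid that unfolding iid_pairs_def by (elim conjE allE impE)
qed

lemma measurable_XY:
  assumes "1 \<le> j"
  shows "random_variable borel (X j)" "random_variable borel (Y j)"
proof -
  have Zj: "Z j \<in> measurable M (borel \<Otimes>\<^sub>M borel)"
    using measurable_Z[OF assms] by (simp add: borel_prod)
  show "random_variable borel (X j)" "random_variable borel (Y j)"
    using measurable_compose[OF Zj measurable_fst] measurable_compose[OF Zj measurable_snd] by simp_all
qed

text \<open>Formulated on pairs so that these indicators can serve as index functions of
  \<open>emp_process\<close>.\<close>

definition indX :: "real \<Rightarrow> real \<times> real \<Rightarrow> real" where "indX s z = of_bool (fst z \<le> s)"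
definition indY :: "real \<Rightarrow> real \<times> real \<Rightarrow> real" where "indY t z = of_bool (snd z \<le> t)"
definition indXY :: "real \<Rightarrow> real \<Rightarrow> real \<times> real \<Rightarrow> real" where "indXY s t z = indX s z * indY t z"

lemma measurable_ind [measurable]:
  "indX s \<in> borel_measurable borel" "indY s \<in> borel_measurable borel" "indXY s t \<in> borel_measurable borel"
proof -
  have [measurable]: "indX s \<in> borel_measurable (borel \<Otimes>\<^sub>M borel)" "indY s \<in> borel_measurable (borel \<Otimes>\<^sub>M borel)" for s
    unfolding indX_def indY_def of_bool_def by measurable
  have "indXY s t \<in> borel_measurable (borel \<Otimes>\<^sub>M borel)"
    unfolding indXY_def by measurable
  then show "indX s \<in> borel_measurable borel" "indY s \<in> borel_measurable borel" "indXY s t \<in> borel_measurable borel"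
    by (simp_all add: borel_prod flip: borel_prod)
qed

lemma ind_bound: "\<bar>indX s z\<bar> \<le> 1" "\<bar>indY s z\<bar> \<le> 1" "\<bar>indXY s t z\<bar> \<le> 1"
  by (auto simp: indX_def indY_def indXY_def)

lemmas integrable_ind = integrable_Z[OF measurable_ind(1) ind_bound(1)]
  integrable_Z[OF measurable_ind(2) ind_bound(2)] integrable_Z[OF measurable_ind(3) ind_bound(3)]

lemma expectation_ind:
  "expectation (\<lambda>\<omega>. indX s (Z 1 \<omega>)) = F s"
  "expectation (\<lambda>\<omega>. indY t (Z 1 \<omega>)) = G t"
  "expectation (\<lambda>\<omega>. indXY s t (Z 1 \<omega>)) = C (F s) (G t)"
proof -
  note [measurable] = measurable_XY[of 1, simplified]
  have E: "expectation (\<lambda>\<omega>. of_bool (P \<omega>)) = prob {\<omega> \<in> space M. P \<omega>}"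
    if "{\<omega> \<in> space M. P \<omega>} \<in> events" for P
  proof -
    have "expectation (\<lambda>\<omega>. of_bool (P \<omega>)) = expectation (indicator {\<omega> \<in> space M. P \<omega>})"
      by (rule Bochner_Integration.integral_cong) (auto simp: indicator_def)
    also have "\<dots> = prob {\<omega> \<in> space M. P \<omega>}" using that by (simp add: Int_absorb2 sets.sets_into_space)
    finally show ?thesis .
  qed
  have dist: "cdf (distr M borel W) s = prob {\<omega> \<in> space M. W \<omega> \<le> s}"
    if "random_variable borel W" for W s
    using that by (simp add: cdf_def2 measure_distr vimage_def Int_def conj_commute)
  show "expectation (\<lambda>\<omega>. indX s (Z 1 \<omega>)) = F s" "expectation (\<lambda>\<omega>. indY t (Z 1 \<omega>)) = G t"
    unfolding indX_def indY_def fst_conv snd_conv by (subst E; simp add: dist)+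
  have "(\<lambda>\<omega>. indXY s t (Z 1 \<omega>)) = (\<lambda>\<omega>. of_bool (X 1 \<omega> \<le> s \<and> Y 1 \<omega> \<le> t))"
    by (simp add: indXY_def indX_def indY_def fun_eq_iff)
  then show "expectation (\<lambda>\<omega>. indXY s t (Z 1 \<omega>)) = C (F s) (G t)"
    using cop by (simp add: E copula_of_def)
qed

lemma
  assumes "1 \<le> n"
  shows emp_process_indX: "emp_process (indX s) n \<omega> = sqrt (real n) * (emp_cdf n (\<lambda>j. X j \<omega>) s - F s)"
    and emp_process_indY: "emp_process (indY t) n \<omega> = sqrt (real n) * (emp_cdf n (\<lambda>j. Y j \<omega>) t - G t)"
    and emp_process_indXY: "emp_process (indXY s t) n \<omega>
      = sqrt (real n) * (emp_joint n (\<lambda>j. X j \<omega>) (\<lambda>j. Y j \<omega>) s t - C (F s) (G t))"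
  unfolding emp_process_eq_mean[OF assms] expectation_ind emp_cdf_def emp_joint_def
  by (simp_all add: indX_def indY_def indXY_def)

text \<open>Arbitrary preimages under the marginal distribution functions; specified only for arguments
  in the open unit interval.\<close>

definition quantX :: "real \<Rightarrow> real" where "quantX u = (SOME s. F s = u)"
definition quantY :: "real \<Rightarrow> real" where "quantY v = (SOME t. G t = v)"

lemma cdf_quant:
  assumes "u \<in> {0<..<1}"
  shows "F (quantX u) = u" "G (quantY u) = u"
proof -
  interpret FX: real_distribution "distr M borel (X 1)"
    by (rule real_distribution_distr) (simp add: measurable_XY)
  interpret GY: real_distribution "distr M borel (Y 1)"
    by (rule real_distribution_distr) (simp add: measurable_XY)
  show "F (quantX u) = u" unfolding quantX_def
    by (rule someI_ex, rule FX.cdf_surj) (use contX assms in \<open>auto simp: continuous_on_eq_continuous_at\<close>)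
  show "G (quantY u) = u" unfolding quantY_def
    by (rule someI_ex, rule GY.cdf_surj) (use contY assms in \<open>auto simp: continuous_on_eq_continuous_at\<close>)
qed

section \<open>Increments of the empirical distribution functions at distance
  \<open>1 / sqrt n\<close>\<close>

lemma expectation_abs_ind_diff:
  "expectation (\<lambda>\<omega>. \<bar>indX s (Z 1 \<omega>) - indX s' (Z 1 \<omega>)\<bar>) = \<bar>F s - F s'\<bar>"
  "expectation (\<lambda>\<omega>. \<bar>indY s (Z 1 \<omega>) - indY s' (Z 1 \<omega>)\<bar>) = \<bar>G s - G s'\<bar>"
proof -
  \<comment> \<open>For ordered arguments the difference of indicators is nonnegative, so the
    absolute value disappears and linearity applies. The general case follows by exchanging the
    arguments.\<close>
  have X: "expectation (\<lambda>\<omega>. \<bar>indX s (Z 1 \<omega>) - indX s' (Z 1 \<omega>)\<bar>) = F s - F s'"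
    and Y: "expectation (\<lambda>\<omega>. \<bar>indY s (Z 1 \<omega>) - indY s' (Z 1 \<omega>)\<bar>) = G s - G s'" if "s' \<le> s" for s s'
  proof -
    have eq: "\<bar>indX s z - indX s' z\<bar> = indX s z - indX s' z" "\<bar>indY s z - indY s' z\<bar> = indY s z - indY s' z" for z
      using that by (auto simp: indX_def indY_def)
    show "expectation (\<lambda>\<omega>. \<bar>indX s (Z 1 \<omega>) - indX s' (Z 1 \<omega>)\<bar>) = F s - F s'"
      "expectation (\<lambda>\<omega>. \<bar>indY s (Z 1 \<omega>) - indY s' (Z 1 \<omega>)\<bar>) = G s - G s'"
      unfolding eq by (simp_all add: integrable_ind expectation_ind[simplified])
  qed
  interpret FX: real_distribution "distr M borel (X 1)"
    by (rule real_distribution_distr) (simp add: measurable_XY)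
  interpret GY: real_distribution "distr M borel (Y 1)"
    by (rule real_distribution_distr) (simp add: measurable_XY)
  show "expectation (\<lambda>\<omega>. \<bar>indX s (Z 1 \<omega>) - indX s' (Z 1 \<omega>)\<bar>) = \<bar>F s - F s'\<bar>"
    using X[of s s'] X[of s' s] FX.cdf_nondecreasing[of s s'] FX.cdf_nondecreasing[of s' s]
    by (cases "s \<le> s'") (simp_all add: abs_minus_commute)
  show "expectation (\<lambda>\<omega>. \<bar>indY s (Z 1 \<omega>) - indY s' (Z 1 \<omega>)\<bar>) = \<bar>G s - G s'\<bar>"
    using Y[of s s'] Y[of s' s] GY.cdf_nondecreasing[of s s'] GY.cdf_nondecreasing[of s' s]
    by (cases "s \<le> s'") (simp_all add: abs_minus_commute)
qed

text \<open>Bundles the two conditions under which \<open>cdf_quant\<close> and the identities for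
  \<open>emp_process\<close> apply at a local point.\<close>

lemma local_points_eventually:
  "\<forall>\<^sub>F n in sequentially. 1 \<le> n \<and> \<alpha> + s / sqrt (real n) \<in> {0<..<1}"
proof -
  have "(\<lambda>n. \<alpha> + s * (1 / sqrt (real n))) \<longlonglongrightarrow> \<alpha> + s * 0"
    using filterlim_inverse_sqrt by (intro tendsto_intros) (simp add: filterlim_at)
  then have lim: "(\<lambda>n. \<alpha> + s / sqrt (real n)) \<longlonglongrightarrow> \<alpha>" by simp
  show ?thesis
    using order_tendstoD[OF lim] \<alpha> eventually_ge_at_top[of 1]
    by (auto intro!: eventually_conj)
qed

text \<open>Local points are placed on the probability scale, so eventually their marginal
  probability exceeds \<alpha> by exactly \<open>s / sqrt n\<close>.\<close>

definition locX :: "nat \<Rightarrow> real \<Rightarrow> real" where "locX n s = quantX (\<alpha> + s / sqrt (real n))"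
definition locY :: "nat \<Rightarrow> real \<Rightarrow> real" where "locY n t = quantY (\<alpha> + t / sqrt (real n))"
abbreviation "a \<equiv> quantX \<alpha>"
abbreviation "b \<equiv> quantY \<alpha>"

lemma cdf_ab: "F a = \<alpha>" "G b = \<alpha>"
  using cdf_quant[of \<alpha>] \<alpha> by auto

lemma tendsto_abs_inverse_sqrt: "(\<lambda>n. \<bar>s\<bar> / sqrt (real n)) \<longlonglongrightarrow> 0"
  by (rule tendsto_divide_0[OF tendsto_const])
    (rule filterlim_at_top_imp_at_infinity[OF filterlim_compose[OF sqrt_at_top filterlim_real_sequentially]])

text \<open>The square of a difference of two indicators is its absolute value, whose expectation at
  a local point is eventually \<open>\<bar>s\<bar> / sqrt n\<close>. For the joint indicators the
  square is dominated by the sum of the two marginal differences.\<close>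

lemma local_second_moments:
  "(\<lambda>n. expectation (\<lambda>\<omega>. (indX (locX n s) (Z 1 \<omega>) - indX a (Z 1 \<omega>))\<^sup>2)) \<longlonglongrightarrow> 0"
  "(\<lambda>n. expectation (\<lambda>\<omega>. (indY (locY n t) (Z 1 \<omega>) - indY b (Z 1 \<omega>))\<^sup>2)) \<longlonglongrightarrow> 0"
  "(\<lambda>n. expectation (\<lambda>\<omega>. (indXY (locX n s) (locY n t) (Z 1 \<omega>) - indXY a b (Z 1 \<omega>))\<^sup>2)) \<longlonglongrightarrow> 0"
proof -
  have sqX: "(indX u z - indX u' z)\<^sup>2 = \<bar>indX u z - indX u' z\<bar>"
    and sqY: "(indY u z - indY u' z)\<^sup>2 = \<bar>indY u z - indY u' z\<bar>" for u u' z
    by (auto simp: indX_def indY_def)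
  have X: "(\<lambda>n. expectation (\<lambda>\<omega>. \<bar>indX (locX n s) (Z 1 \<omega>) - indX a (Z 1 \<omega>)\<bar>)) \<longlonglongrightarrow> 0"
    unfolding expectation_abs_ind_diff
    by (rule Lim_transform_eventually[OF tendsto_abs_inverse_sqrt[of s]],
        rule eventually_mono[OF local_points_eventually[of s]])
      (auto simp: locX_def cdf_quant cdf_ab abs_divide simp del: One_nat_def)
  have Y: "(\<lambda>n. expectation (\<lambda>\<omega>. \<bar>indY (locY n t) (Z 1 \<omega>) - indY b (Z 1 \<omega>)\<bar>)) \<longlonglongrightarrow> 0"
    unfolding expectation_abs_ind_diff
    by (rule Lim_transform_eventually[OF tendsto_abs_inverse_sqrt[of t]],
        rule eventually_mono[OF local_points_eventually[of t]])
      (auto simp: locY_def cdf_quant cdf_ab abs_divide simp del: One_nat_def)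
  show "(\<lambda>n. expectation (\<lambda>\<omega>. (indX (locX n s) (Z 1 \<omega>) - indX a (Z 1 \<omega>))\<^sup>2)) \<longlonglongrightarrow> 0"
    "(\<lambda>n. expectation (\<lambda>\<omega>. (indY (locY n t) (Z 1 \<omega>) - indY b (Z 1 \<omega>))\<^sup>2)) \<longlonglongrightarrow> 0"
    unfolding sqX sqY by (rule X, rule Y)
  show "(\<lambda>n. expectation (\<lambda>\<omega>. (indXY (locX n s) (locY n t) (Z 1 \<omega>) - indXY a b (Z 1 \<omega>))\<^sup>2)) \<longlonglongrightarrow> 0"
  proof (rule tendsto_sandwich[OF _ _ tendsto_const])
    show "\<forall>\<^sub>F n in sequentially. expectation (\<lambda>\<omega>. (indXY (locX n s) (locY n t) (Z 1 \<omega>) - indXY a b (Z 1 \<omega>))\<^sup>2)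
      \<le> expectation (\<lambda>\<omega>. \<bar>indX (locX n s) (Z 1 \<omega>) - indX a (Z 1 \<omega>)\<bar>)
        + expectation (\<lambda>\<omega>. \<bar>indY (locY n t) (Z 1 \<omega>) - indY b (Z 1 \<omega>)\<bar>)"
    proof (rule always_eventually, rule allI)
      fix n
      have *: "(indXY u v z - indXY u' v' z)\<^sup>2 \<le> \<bar>indX u z - indX u' z\<bar> + \<bar>indY v z - indY v' z\<bar>" for u v u' v' z
        by (auto simp: indX_def indY_def indXY_def)
      have "expectation (\<lambda>\<omega>. (indXY (locX n s) (locY n t) (Z 1 \<omega>) - indXY a b (Z 1 \<omega>))\<^sup>2)
        \<le> expectation (\<lambda>\<omega>. \<bar>indX (locX n s) (Z 1 \<omega>) - indX a (Z 1 \<omega>)\<bar> + \<bar>indY (locY n t) (Z 1 \<omega>) - indY b (Z 1 \<omega>)\<bar>)"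
        by (rule integral_mono') (auto intro!: * integrable_ind[of 1, simplified] integrable_abs
            Bochner_Integration.integrable_add Bochner_Integration.integrable_diff)
      also have "\<dots> = expectation (\<lambda>\<omega>. \<bar>indX (locX n s) (Z 1 \<omega>) - indX a (Z 1 \<omega>)\<bar>)
        + expectation (\<lambda>\<omega>. \<bar>indY (locY n t) (Z 1 \<omega>) - indY b (Z 1 \<omega>)\<bar>)"
        by (rule Bochner_Integration.integral_add) (auto intro!: integrable_ind[of 1, simplified] integrable_abs
            Bochner_Integration.integrable_diff)
      finally show "expectation (\<lambda>\<omega>. (indXY (locX n s) (locY n t) (Z 1 \<omega>) - indXY a b (Z 1 \<omega>))\<^sup>2)
        \<le> expectation (\<lambda>\<omega>. \<bar>indX (locX n s) (Z 1 \<omega>) - indX a (Z 1 \<omega>)\<bar>)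
          + expectation (\<lambda>\<omega>. \<bar>indY (locY n t) (Z 1 \<omega>) - indY b (Z 1 \<omega>)\<bar>)" .
    qed
    show "(\<lambda>n. expectation (\<lambda>\<omega>. \<bar>indX (locX n s) (Z 1 \<omega>) - indX a (Z 1 \<omega>)\<bar>)
        + expectation (\<lambda>\<omega>. \<bar>indY (locY n t) (Z 1 \<omega>) - indY b (Z 1 \<omega>)\<bar>)) \<longlonglongrightarrow> 0"
      using tendsto_add[OF X Y] by simp
  qed (auto intro!: always_eventually integral_nonneg_AE)
qed


text \<open>Each increment is its mean plus the empirical process of a difference of indicators,
  which vanishes by \<open>emp_process_vanishing\<close>. The scaled marginal means are eventually
  exactly \<open>s\<close> and \<open>t\<close>; the scaled joint mean converges to the linear form
  by differentiability of \<open>C\<close>.\<close>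

lemma local_increment_tendsto_prob:
  assumes \<eta>: "0 < \<eta>"
  shows "(\<lambda>n. prob {\<omega> \<in> space M. \<eta> \<le> \<bar>sqrt (real n) * (emp_cdf n (\<lambda>j. X j \<omega>) (locX n s)
      - emp_cdf n (\<lambda>j. X j \<omega>) a) - s\<bar>}) \<longlonglongrightarrow> 0"
    and "(\<lambda>n. prob {\<omega> \<in> space M. \<eta> \<le> \<bar>sqrt (real n) * (emp_cdf n (\<lambda>j. Y j \<omega>) (locY n t)
      - emp_cdf n (\<lambda>j. Y j \<omega>) b) - t\<bar>}) \<longlonglongrightarrow> 0"
    and "(\<lambda>n. prob {\<omega> \<in> space M. \<eta> \<le> \<bar>sqrt (real n) * (emp_joint n (\<lambda>j. X j \<omega>) (\<lambda>j. Y j \<omega>) (locX n s) (locY n t)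
      - emp_joint n (\<lambda>j. X j \<omega>) (\<lambda>j. Y j \<omega>) a b) - (h1 C \<alpha> \<alpha> * s + h2 C \<alpha> \<alpha> * t)\<bar>}) \<longlonglongrightarrow> 0"
proof -
  note int = integrable_ind[of 1, OF order_refl]
  have "(\<lambda>n. prob {\<omega> \<in> space M. \<eta> \<le> \<bar>emp_process (\<lambda>z. indX (locX n s) z - indX a z) n \<omega> + 0\<bar>}) \<longlonglongrightarrow> 0"
  proof (rule emp_process_vanishing[where f = "\<lambda>n z. indX (locX n s) z - indX a z" and B = 2])
    show "(\<lambda>z. indX (locX n s) z - indX a z) \<in> borel_measurable borel" "\<bar>indX (locX n s) z - indX a z\<bar> \<le> 2" for n z
      by (measurable, rule order_trans[OF abs_triangle_ineq4 add_mono[OF ind_bound(1) ind_bound(1), simplified]])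
  qed (rule local_second_moments(1) tendsto_const \<eta>)+
  then show "(\<lambda>n. prob {\<omega> \<in> space M. \<eta> \<le> \<bar>sqrt (real n) * (emp_cdf n (\<lambda>j. X j \<omega>) (locX n s)
      - emp_cdf n (\<lambda>j. X j \<omega>) a) - s\<bar>}) \<longlonglongrightarrow> 0"
  proof (rule Lim_transform_eventually, intro eventually_mono[OF local_points_eventually[of s]])
    fix n assume n: "1 \<le> n \<and> \<alpha> + s / sqrt (real n) \<in> {0<..<1}"
    have "emp_process (\<lambda>z. indX (locX n s) z - indX a z) n \<omega> + 0
      = sqrt (real n) * (emp_cdf n (\<lambda>j. X j \<omega>) (locX n s) - emp_cdf n (\<lambda>j. X j \<omega>) a) - s" for \<omega>
      using n unfolding emp_process_diff[OF int(1) int(1)] emp_process_indX[OF conjunct1[OF n]]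
      by (simp add: cdf_ab cdf_quant locX_def algebra_simps del: One_nat_def)
    then show "prob {\<omega> \<in> space M. \<eta> \<le> \<bar>emp_process (\<lambda>z. indX (locX n s) z - indX a z) n \<omega> + 0\<bar>}
      = prob {\<omega> \<in> space M. \<eta> \<le> \<bar>sqrt (real n) * (emp_cdf n (\<lambda>j. X j \<omega>) (locX n s)
      - emp_cdf n (\<lambda>j. X j \<omega>) a) - s\<bar>}" by (simp only:)
  qed
  have "(\<lambda>n. prob {\<omega> \<in> space M. \<eta> \<le> \<bar>emp_process (\<lambda>z. indY (locY n t) z - indY b z) n \<omega> + 0\<bar>}) \<longlonglongrightarrow> 0"
  proof (rule emp_process_vanishing[where f = "\<lambda>n z. indY (locY n t) z - indY b z" and B = 2])
    show "(\<lambda>z. indY (locY n t) z - indY b z) \<in> borel_measurable borel" "\<bar>indY (locY n t) z - indY b z\<bar> \<le> 2" for n z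
      by (measurable, rule order_trans[OF abs_triangle_ineq4 add_mono[OF ind_bound(2) ind_bound(2), simplified]])
  qed (rule local_second_moments(2) tendsto_const \<eta>)+
  then show "(\<lambda>n. prob {\<omega> \<in> space M. \<eta> \<le> \<bar>sqrt (real n) * (emp_cdf n (\<lambda>j. Y j \<omega>) (locY n t)
      - emp_cdf n (\<lambda>j. Y j \<omega>) b) - t\<bar>}) \<longlonglongrightarrow> 0"
  proof (rule Lim_transform_eventually, intro eventually_mono[OF local_points_eventually[of t]])
    fix n assume n: "1 \<le> n \<and> \<alpha> + t / sqrt (real n) \<in> {0<..<1}"
    have "emp_process (\<lambda>z. indY (locY n t) z - indY b z) n \<omega> + 0
      = sqrt (real n) * (emp_cdf n (\<lambda>j. Y j \<omega>) (locY n t) - emp_cdf n (\<lambda>j. Y j \<omega>) b) - t" for \<omega>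
      using n unfolding emp_process_diff[OF int(2) int(2)] emp_process_indY[OF conjunct1[OF n]]
      by (simp add: cdf_ab cdf_quant locY_def algebra_simps del: One_nat_def)
    then show "prob {\<omega> \<in> space M. \<eta> \<le> \<bar>emp_process (\<lambda>z. indY (locY n t) z - indY b z) n \<omega> + 0\<bar>}
      = prob {\<omega> \<in> space M. \<eta> \<le> \<bar>sqrt (real n) * (emp_cdf n (\<lambda>j. Y j \<omega>) (locY n t)
      - emp_cdf n (\<lambda>j. Y j \<omega>) b) - t\<bar>}" by (simp only:)
  qed
  let ?m = "h1 C \<alpha> \<alpha> * s + h2 C \<alpha> \<alpha> * t"
  \<comment> \<open>The error made by replacing the scaled copula increment with its linear form,
    which plays the role of the drift.\<close>
  let ?c = "\<lambda>n. sqrt (real n) * (C (\<alpha> + s / sqrt (real n)) (\<alpha> + t / sqrt (real n)) - C \<alpha> \<alpha>) - ?m"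
  have "?c \<longlonglongrightarrow> ?m - ?m"
    using \<alpha> by (intro tendsto_diff tendsto_const continuous_partials_increment_tendsto partials) auto
  then have c: "?c \<longlonglongrightarrow> 0" by simp
  have "(\<lambda>n. prob {\<omega> \<in> space M. \<eta> \<le> \<bar>emp_process (\<lambda>z. indXY (locX n s) (locY n t) z - indXY a b z) n \<omega> + ?c n\<bar>}) \<longlonglongrightarrow> 0"
  proof (rule emp_process_vanishing[where f = "\<lambda>n z. indXY (locX n s) (locY n t) z - indXY a b z" and B = 2])
    show "(\<lambda>z. indXY (locX n s) (locY n t) z - indXY a b z) \<in> borel_measurable borel" "\<bar>indXY (locX n s) (locY n t) z - indXY a b z\<bar> \<le> 2" for n z
      by (measurable, rule order_trans[OF abs_triangle_ineq4 add_mono[OF ind_bound(3) ind_bound(3), simplified]])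
  qed (rule local_second_moments(3) c \<eta>)+
  then show "(\<lambda>n. prob {\<omega> \<in> space M. \<eta> \<le> \<bar>sqrt (real n) * (emp_joint n (\<lambda>j. X j \<omega>) (\<lambda>j. Y j \<omega>) (locX n s) (locY n t)
      - emp_joint n (\<lambda>j. X j \<omega>) (\<lambda>j. Y j \<omega>) a b) - ?m\<bar>}) \<longlonglongrightarrow> 0"
  proof (rule Lim_transform_eventually,
      intro eventually_mono[OF eventually_conj[OF local_points_eventually[of s] local_points_eventually[of t]]])
    fix n assume n: "(1 \<le> n \<and> \<alpha> + s / sqrt (real n) \<in> {0<..<1}) \<and> (1 \<le> n \<and> \<alpha> + t / sqrt (real n) \<in> {0<..<1})"
    then have n1: "1 \<le> n" by blast
    have "emp_process (\<lambda>z. indXY (locX n s) (locY n t) z - indXY a b z) n \<omega> + ?c n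
      = sqrt (real n) * (emp_joint n (\<lambda>j. X j \<omega>) (\<lambda>j. Y j \<omega>) (locX n s) (locY n t)
      - emp_joint n (\<lambda>j. X j \<omega>) (\<lambda>j. Y j \<omega>) a b) - ?m" for \<omega>
      using n unfolding emp_process_diff[OF int(3) int(3)] emp_process_indXY[OF n1]
      by (simp add: cdf_ab cdf_quant locX_def locY_def algebra_simps del: One_nat_def)
    then show "prob {\<omega> \<in> space M. \<eta> \<le> \<bar>emp_process (\<lambda>z. indXY (locX n s) (locY n t) z - indXY a b z) n \<omega> + ?c n\<bar>}
      = prob {\<omega> \<in> space M. \<eta> \<le> \<bar>sqrt (real n) * (emp_joint n (\<lambda>j. X j \<omega>) (\<lambda>j. Y j \<omega>) (locX n s) (locY n t)
      - emp_joint n (\<lambda>j. X j \<omega>) (\<lambda>j. Y j \<omega>) a b) - ?m\<bar>}" by (simp only:)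
  qed
qed

lemma measurable_emp_cdf:
  "(\<lambda>\<omega>. emp_cdf n (\<lambda>j. X j \<omega>) s) \<in> borel_measurable M" "(\<lambda>\<omega>. emp_cdf n (\<lambda>j. Y j \<omega>) s) \<in> borel_measurable M"
  "(\<lambda>\<omega>. emp_joint n (\<lambda>j. X j \<omega>) (\<lambda>j. Y j \<omega>) s t) \<in> borel_measurable M"
  "(\<lambda>\<omega>. emp_copula n (\<lambda>j. X j \<omega>) (\<lambda>j. Y j \<omega>) u v) \<in> borel_measurable M"
proof -
  have [measurable]: "random_variable borel (X j)" "random_variable borel (Y j)" if "j \<in> {1..n}" for j
    using that measurable_XY[of j] by auto
  show "(\<lambda>\<omega>. emp_cdf n (\<lambda>j. X j \<omega>) s) \<in> borel_measurable M" "(\<lambda>\<omega>. emp_cdf n (\<lambda>j. Y j \<omega>) s) \<in> borel_measurable M"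
    "(\<lambda>\<omega>. emp_joint n (\<lambda>j. X j \<omega>) (\<lambda>j. Y j \<omega>) s t) \<in> borel_measurable M"
    unfolding emp_cdf_def emp_joint_def of_bool_def by measurable
  show "(\<lambda>\<omega>. emp_copula n (\<lambda>j. X j \<omega>) (\<lambda>j. Y j \<omega>) u v) \<in> borel_measurable M"
    unfolding emp_copula_def emp_cdf_def of_bool_def by measurable
qed

section \<open>The linearisation error and its mean-square convergence\<close>

abbreviation "p \<equiv> h1 C \<alpha> \<alpha>"
abbreviation "q \<equiv> h2 C \<alpha> \<alpha>"

text \<open>The error of the first-order expansion of the empirical copula at \<open>(\<alpha>, \<alpha>)\<close>, scaled by \<open>\<surd>n\<close>;
  see \<open>emp_copula_expansion\<close>.\<close>

definition remainder :: "nat \<Rightarrow> 'a \<Rightarrow> real" where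
  "remainder n \<omega> = sqrt (real n) * (emp_copula n (\<lambda>j. X j \<omega>) (\<lambda>j. Y j \<omega>) \<alpha> \<alpha>
      - emp_joint n (\<lambda>j. X j \<omega>) (\<lambda>j. Y j \<omega>) a b)
    + p * emp_process (indX a) n \<omega> + q * emp_process (indY b) n \<omega>"

lemma measurable_emp_process_ind [measurable]:
  "random_variable borel (emp_process (indX s) n)" "random_variable borel (emp_process (indY s) n)"
  by (rule measurable_emp_process[OF _ ind_bound(1)], simp, rule measurable_emp_process[OF _ ind_bound(2)], simp)

lemma measurable_remainder [measurable]: "random_variable borel (remainder n)"
proof -
  note [measurable] = measurable_emp_cdf
  show ?thesis unfolding remainder_def by measurable
qed

text \<open>Tightness of the marginal processes, uniformly in \<open>n\<close>: the second moment of
  an indicator is at most 1.\<close>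

lemma emp_process_ind_tail:
  assumes "1 \<le> n" "0 < R"
  shows "prob {\<omega> \<in> space M. R \<le> \<bar>emp_process (indX s) n \<omega>\<bar>} \<le> 1 / R\<^sup>2"
    and "prob {\<omega> \<in> space M. R \<le> \<bar>emp_process (indY s) n \<omega>\<bar>} \<le> 1 / R\<^sup>2"
proof -
  have sq: "(indX s z)\<^sup>2 = indX s z" "(indY s z)\<^sup>2 = indY s z" for z
    by (simp_all add: indX_def indY_def)
  have X: "expectation (\<lambda>\<omega>. (indX s (Z 1 \<omega>))\<^sup>2) \<le> 1"
    unfolding sq by (rule integral_le_const[OF integrable_ind(1)[OF order_refl]]) (simp add: indX_def)
  have Y: "expectation (\<lambda>\<omega>. (indY s (Z 1 \<omega>))\<^sup>2) \<le> 1"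
    unfolding sq by (rule integral_le_const[OF integrable_ind(2)[OF order_refl]]) (simp add: indY_def)
  show "prob {\<omega> \<in> space M. R \<le> \<bar>emp_process (indX s) n \<omega>\<bar>} \<le> 1 / R\<^sup>2"
    by (rule order_trans[OF emp_process_tail[OF measurable_ind(1) ind_bound(1) assms] divide_right_mono[OF X]]) simp
  show "prob {\<omega> \<in> space M. R \<le> \<bar>emp_process (indY s) n \<omega>\<bar>} \<le> 1 / R\<^sup>2"
    by (rule order_trans[OF emp_process_tail[OF measurable_ind(2) ind_bound(2) assms] divide_right_mono[OF Y]]) simp
qed

text \<open>Unless a marginal process is large or an increment on the grid is far from its linear
  approximation, \<open>emp_copula_local_sandwich\<close> bounds the remainder by \<epsilon>. The
  grid is finite with size independent of \<open>n\<close>, so the exceptional probabilities can be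
  added up.\<close>

lemma remainder_tendsto_prob:
  assumes \<epsilon>: "0 < \<epsilon>"
  shows "(\<lambda>n. prob {\<omega> \<in> space M. \<epsilon> < \<bar>remainder n \<omega>\<bar>}) \<longlonglongrightarrow> 0"
proof (rule LIMSEQ_I)
  fix \<tau> :: real assume \<tau>: "0 < \<tau>"
  \<comment> \<open>The mesh \<eta> turns the sandwich bound into \<epsilon>. The level
    \<open>R\<close> gives each marginal process a tail probability of at most
    \<open>\<tau> / 4\<close>, leaving \<open>\<tau> / 2\<close> for the grid events collected in
    \<open>bad\<close>. The index bound \<open>N\<close> makes the grid cover deviations up to
    \<open>R\<close>.\<close>
  define \<eta> where "\<eta> = \<epsilon> / (2 * \<bar>p\<bar> + 2 * \<bar>q\<bar> + 1)"
  define R where "R = 2 / sqrt \<tau>"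
  define N where "N = \<lceil>R / \<eta>\<rceil> + 2"
  have \<eta>: "0 < \<eta>" "(2 * \<bar>p\<bar> + 2 * \<bar>q\<bar> + 1) * \<eta> = \<epsilon>"
    using \<epsilon> by (auto simp: \<eta>_def intro!: divide_pos_pos add_nonneg_pos)
  have R: "0 < R" "1 / R\<^sup>2 = \<tau> / 4" using \<tau> by (auto simp: R_def power_divide)
  have N: "R / \<eta> + 2 \<le> of_int N" unfolding N_def by simp
  define BX where "BX n i = {\<omega> \<in> space M. \<eta> \<le> \<bar>sqrt (real n) * (emp_cdf n (\<lambda>j. X j \<omega>) (locX n (of_int i * \<eta>))
      - emp_cdf n (\<lambda>j. X j \<omega>) a) - of_int i * \<eta>\<bar>}" for n and i :: int
  define BY where "BY n i = {\<omega> \<in> space M. \<eta> \<le> \<bar>sqrt (real n) * (emp_cdf n (\<lambda>j. Y j \<omega>) (locY n (of_int i * \<eta>))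
      - emp_cdf n (\<lambda>j. Y j \<omega>) b) - of_int i * \<eta>\<bar>}" for n and i :: int
  define BXY where "BXY n i l = {\<omega> \<in> space M. \<eta> \<le> \<bar>sqrt (real n) * (emp_joint n (\<lambda>j. X j \<omega>) (\<lambda>j. Y j \<omega>)
        (locX n (of_int i * \<eta>)) (locY n (of_int l * \<eta>))
      - emp_joint n (\<lambda>j. X j \<omega>) (\<lambda>j. Y j \<omega>) a b) - (p * (of_int i * \<eta>) + q * (of_int l * \<eta>))\<bar>}" for n and i l :: int
  note [measurable] = measurable_emp_cdf
  have ev: "BX n i \<in> events" "BY n i \<in> events" "BXY n i l \<in> events" for n i l
    unfolding BX_def BY_def BXY_def by measurable
  define bad where "bad n = (\<Sum>i\<in>{-N..N}. prob (BX n i)) + (\<Sum>i\<in>{-N..N}. prob (BY n i))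
      + (\<Sum>z\<in>{-N..N}\<times>{-N..N}. prob (BXY n (fst z) (snd z)))" for n
  have "bad \<longlonglongrightarrow> (\<Sum>i\<in>{-N..N}. 0) + (\<Sum>i\<in>{-N..N}. 0) + (\<Sum>z\<in>{-N..N}\<times>{-N..N}. 0)"
    unfolding bad_def BX_def BY_def BXY_def
    by (intro tendsto_add tendsto_sum local_increment_tendsto_prob \<eta>)
  then have "bad \<longlonglongrightarrow> 0" by simp
  then have "\<forall>\<^sub>F n in sequentially. bad n < \<tau> / 2" using \<tau> by (intro order_tendstoD(2)) auto
  with eventually_ge_at_top[of 1]
  have "\<forall>\<^sub>F n in sequentially. norm (prob {\<omega> \<in> space M. \<epsilon> < \<bar>remainder n \<omega>\<bar>} - 0) < \<tau>"
  proof eventually_elim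
    case (elim n)
    let ?TX = "{\<omega> \<in> space M. R \<le> \<bar>emp_process (indX a) n \<omega>\<bar>}"
    let ?TY = "{\<omega> \<in> space M. R \<le> \<bar>emp_process (indY b) n \<omega>\<bar>}"
    let ?UX = "\<Union>i\<in>{-N..N}. BX n i" and ?UY = "\<Union>i\<in>{-N..N}. BY n i"
    let ?UXY = "\<Union>z\<in>{-N..N}\<times>{-N..N}. BXY n (fst z) (snd z)"
    have "{\<omega> \<in> space M. \<epsilon> < \<bar>remainder n \<omega>\<bar>} \<subseteq> ?TX \<union> ?TY \<union> ?UX \<union> ?UY \<union> ?UXY"
    proof (rule subsetI, rule ccontr)
      fix \<omega> assume \<omega>: "\<omega> \<in> {\<omega> \<in> space M. \<epsilon> < \<bar>remainder n \<omega>\<bar>}" and not: "\<omega> \<notin> ?TX \<union> ?TY \<union> ?UX \<union> ?UY \<union> ?UXY"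
      let ?x = "\<lambda>j. X j \<omega>" and ?y = "\<lambda>j. Y j \<omega>" and ?r = "sqrt (real n)"
      have "\<bar>?r * (emp_copula n ?x ?y \<alpha> \<alpha> - emp_joint n ?x ?y a b)
        + p * (?r * (emp_cdf n ?x a - \<alpha>)) + q * (?r * (emp_cdf n ?y b - \<alpha>))\<bar> \<le> (2 * \<bar>p\<bar> + 2 * \<bar>q\<bar> + 1) * \<eta>"
      proof (rule emp_copula_local_sandwich[where R = R and N = N
            and sX = "\<lambda>i. locX n (of_int i * \<eta>)" and sY = "\<lambda>i. locY n (of_int i * \<eta>)"])
        show "\<bar>?r * (emp_cdf n ?x a - \<alpha>)\<bar> < R" "\<bar>?r * (emp_cdf n ?y b - \<alpha>)\<bar> < R"
          using not \<omega> unfolding emp_process_indX[OF elim(1)] emp_process_indY[OF elim(1)] cdf_ab by auto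
        show "\<bar>?r * (emp_cdf n ?x (locX n (of_int i * \<eta>)) - emp_cdf n ?x a) - of_int i * \<eta>\<bar> < \<eta>"
          if "i \<in> {-N..N}" for i
          using not \<omega> that unfolding BX_def by force
        show "\<bar>?r * (emp_cdf n ?y (locY n (of_int i * \<eta>)) - emp_cdf n ?y b) - of_int i * \<eta>\<bar> < \<eta>"
          if "i \<in> {-N..N}" for i
          using not \<omega> that unfolding BY_def by force
        show "\<bar>?r * (emp_joint n ?x ?y (locX n (of_int i * \<eta>)) (locY n (of_int l * \<eta>)) - emp_joint n ?x ?y a b)
          - (p * (of_int i * \<eta>) + q * (of_int l * \<eta>))\<bar> < \<eta>"
          if "i \<in> {-N..N}" "l \<in> {-N..N}" for i l
        proof -
          have "\<omega> \<notin> BXY n i l" using not that by auto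
          then show ?thesis using \<omega> unfolding BXY_def by auto
        qed
      qed (use elim(1) \<eta> N in auto)
      then have "\<bar>remainder n \<omega>\<bar> \<le> \<epsilon>"
        unfolding remainder_def emp_process_indX[OF elim(1)] emp_process_indY[OF elim(1)] cdf_ab \<eta>(2) .
      with \<omega> show False by simp
    qed
    then have "prob {\<omega> \<in> space M. \<epsilon> < \<bar>remainder n \<omega>\<bar>} \<le> prob (?TX \<union> ?TY \<union> ?UX \<union> ?UY \<union> ?UXY)"
      using ev by (intro finite_measure_mono) auto
    also have "\<dots> \<le> prob ?TX + prob ?TY + prob ?UX + prob ?UY + prob ?UXY"
      using ev by (intro order_trans[OF measure_Un_le] add_mono order_refl) auto
    also have "\<dots> \<le> \<tau> / 4 + \<tau> / 4 + (\<Sum>i\<in>{-N..N}. prob (BX n i)) + (\<Sum>i\<in>{-N..N}. prob (BY n i))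
        + (\<Sum>z\<in>{-N..N}\<times>{-N..N}. prob (BXY n (fst z) (snd z)))"
      using ev emp_process_ind_tail[OF elim(1) R(1)] unfolding R(2)
      by (intro add_mono finite_measure_subadditive_finite) auto
    also have "\<dots> < \<tau>" using elim(2) unfolding bad_def by simp
    finally show ?case by simp
  qed
  then show "\<exists>no. \<forall>n\<ge>no. norm (prob {\<omega> \<in> space M. \<epsilon> < \<bar>remainder n \<omega>\<bar>} - 0) < \<tau>"
    by (simp add: eventually_sequentially)
qed

text \<open>The coordinates of independent pairs are independent sequences, and each coordinate
  inherits a continuous distribution function from the first observation.\<close>

lemma AE_no_ties:
  "AE \<omega> in M. inj_on (\<lambda>j. X j \<omega>) {1..n} \<and> inj_on (\<lambda>j. Y j \<omega>) {1..n}"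
proof -
  have Z: "indep_vars (\<lambda>_. borel \<Otimes>\<^sub>M borel) Z {1..n}"
    using indep_vars_subset[OF indep, of "{1..n}"] by (auto simp: borel_prod)
  have X: "indep_vars (\<lambda>_. borel) X {1..n}" and Y: "indep_vars (\<lambda>_. borel) Y {1..n}"
    using indep_vars_compose2[OF Z, of "\<lambda>_. fst" "\<lambda>_. borel"] indep_vars_compose2[OF Z, of "\<lambda>_. snd" "\<lambda>_. borel"]
    by simp_all
  \<comment> \<open>A marginal law is the image of the law of the pair under a projection, so
    identically distributed pairs have identically distributed coordinates.\<close>
  have eqd: "distr M borel (X j) = distr M borel (X 1)" "distr M borel (Y j) = distr M borel (Y 1)" if j: "1 \<le> j" for j
  proof -
    have X: "distr M borel (X j) = distr (distr M borel (Z j)) borel fst"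
      and Y: "distr M borel (Y j) = distr (distr M borel (Z j)) borel snd" if "1 \<le> j" for j
      using measurable_Z[OF that] by (simp_all add: distr_distr comp_def borel_measurable_continuous_onI continuous_on_fst continuous_on_snd)
    show "distr M borel (X j) = distr M borel (X 1)" "distr M borel (Y j) = distr M borel (Y 1)"
      unfolding X[OF j] Y[OF j] X[OF order_refl] Y[OF order_refl] ident[OF j] by (rule refl)+
  qed
  have cont1: "isCont F x" "isCont G x" for x
    using contX contY by (auto simp: continuous_on_eq_continuous_at)
  have contj: "isCont (cdf (distr M borel (X j))) x" "isCont (cdf (distr M borel (Y j))) x" if "j \<in> {1..n}" for j x
  proof -
    have "1 \<le> j" using that by simp
    from eqd[OF this] show "isCont (cdf (distr M borel (X j))) x" "isCont (cdf (distr M borel (Y j))) x"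
      by (simp_all only: cont1)
  qed
  show ?thesis
    by (rule AE_conjI; rule AE_inj_on_of_continuous_cdf)
      (simp_all only: X Y contj finite_atLeastAtMost)
qed

lemma integrable_remainder_power: "integrable M (\<lambda>\<omega>. remainder n \<omega> ^ k)"
proof -
  let ?B = "sqrt (real n) * 2 + \<bar>p\<bar> * (real n * (2 * 1) / sqrt (real n)) + \<bar>q\<bar> * (real n * (2 * 1) / sqrt (real n))"
  have "\<bar>remainder n \<omega>\<bar> \<le> ?B" for \<omega>
    unfolding remainder_def
  proof (intro order_trans[OF abs_triangle_ineq] add_mono)
    show "\<bar>sqrt (real n) * (emp_copula n (\<lambda>j. X j \<omega>) (\<lambda>j. Y j \<omega>) \<alpha> \<alpha>
      - emp_joint n (\<lambda>j. X j \<omega>) (\<lambda>j. Y j \<omega>) a b)\<bar> \<le> sqrt (real n) * 2"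
      unfolding abs_mult
      using abs_emp_le(2)[of n "\<lambda>j. X j \<omega>" "\<lambda>j. Y j \<omega>" \<alpha> \<alpha>] abs_emp_le(1)[of n "\<lambda>j. X j \<omega>" "\<lambda>j. Y j \<omega>" a b]
      by (intro mult_mono) auto
    show "\<bar>p * emp_process (indX a) n \<omega>\<bar> \<le> \<bar>p\<bar> * (real n * (2 * 1) / sqrt (real n))"
      unfolding abs_mult by (intro mult_left_mono emp_process_bound measurable_ind ind_bound) simp
    show "\<bar>q * emp_process (indY b) n \<omega>\<bar> \<le> \<bar>q\<bar> * (real n * (2 * 1) / sqrt (real n))"
      unfolding abs_mult by (intro mult_left_mono emp_process_bound measurable_ind ind_bound) simp
  qed
  then show ?thesis
    by (intro integrable_bounded[of _ "?B ^ k"]) (auto simp: power_abs intro!: power_mono)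
qed

text \<open>Almost surely there are no ties, and then \<open>emp_copula_emp_joint_bound\<close>
  bounds the scaled difference of \<open>emp_copula\<close> and \<open>emp_joint\<close> by the two
  marginal processes plus 2. In the constant, 27 comes from \<open>power4_sum3_le\<close>, 48 is
  \<open>3 * (2 * 1) ^ 4\<close> from \<open>emp_process_moments\<close>, and 16 is
  \<open>2 ^ 4\<close>.\<close>

lemma remainder_fourth_moment:
  assumes n: "1 \<le> n"
  shows "expectation (\<lambda>\<omega>. remainder n \<omega> ^ 4) \<le> 27 * ((1 + \<bar>p\<bar>) ^ 4 * 48 + (1 + \<bar>q\<bar>) ^ 4 * 48 + 16)"
proof -
  let ?U = "\<lambda>\<omega>. emp_process (indX a) n \<omega>" and ?V = "\<lambda>\<omega>. emp_process (indY b) n \<omega>"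
  have int: "integrable M (\<lambda>\<omega>. ?U \<omega> ^ 4)" "integrable M (\<lambda>\<omega>. ?V \<omega> ^ 4)"
    by (rule integrable_emp_process_power[OF measurable_ind(1) ind_bound(1)],
        rule integrable_emp_process_power[OF measurable_ind(2) ind_bound(2)])
  have "AE \<omega> in M. remainder n \<omega> ^ 4 \<le> 27 * ((1 + \<bar>p\<bar>) ^ 4 * ?U \<omega> ^ 4 + (1 + \<bar>q\<bar>) ^ 4 * ?V \<omega> ^ 4 + 16)"
    using AE_no_ties[of n]
  proof (rule AE_mp, intro AE_I2 impI)
    fix \<omega> assume inj: "inj_on (\<lambda>j. X j \<omega>) {1..n} \<and> inj_on (\<lambda>j. Y j \<omega>) {1..n}"
    let ?x = "\<lambda>j. X j \<omega>" and ?y = "\<lambda>j. Y j \<omega>" and ?r = "sqrt (real n)"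
    have r: "0 < ?r" "1 \<le> ?r" using n by auto
    have "\<bar>?r * (emp_copula n ?x ?y \<alpha> \<alpha> - emp_joint n ?x ?y a b)\<bar>
        \<le> ?r * (\<bar>\<alpha> - emp_cdf n ?x a\<bar> + \<bar>\<alpha> - emp_cdf n ?y b\<bar> + 2 / real n)"
      unfolding abs_mult using inj \<alpha> n
      by (intro mult_mono emp_copula_emp_joint_bound) auto
    also have "\<dots> = \<bar>?U \<omega>\<bar> + \<bar>?V \<omega>\<bar> + ?r * (2 / real n)"
      unfolding emp_process_indX[OF n] emp_process_indY[OF n] cdf_ab
      using r by (simp add: abs_mult distrib_left abs_minus_commute)
    also have "?r * (2 / real n) \<le> 2"
    proof -
      have "?r * (2 / real n) = 2 / ?r" using n by (simp add: field_simps)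
      also have "\<dots> \<le> 2" using r by (simp add: field_simps)
      finally show ?thesis .
    qed
    finally have "\<bar>?r * (emp_copula n ?x ?y \<alpha> \<alpha> - emp_joint n ?x ?y a b)\<bar> \<le> \<bar>?U \<omega>\<bar> + \<bar>?V \<omega>\<bar> + 2" by simp
    moreover have "\<bar>p * ?U \<omega>\<bar> = \<bar>p\<bar> * \<bar>?U \<omega>\<bar>" "\<bar>q * ?V \<omega>\<bar> = \<bar>q\<bar> * \<bar>?V \<omega>\<bar>" by (simp_all add: abs_mult)
    ultimately have "\<bar>remainder n \<omega>\<bar> \<le> (1 + \<bar>p\<bar>) * \<bar>?U \<omega>\<bar> + (1 + \<bar>q\<bar>) * \<bar>?V \<omega>\<bar> + 2"
      unfolding remainder_def distrib_right mult_1 by linarith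
    then have "\<bar>remainder n \<omega>\<bar> ^ 4 \<le> ((1 + \<bar>p\<bar>) * \<bar>?U \<omega>\<bar> + (1 + \<bar>q\<bar>) * \<bar>?V \<omega>\<bar> + 2) ^ 4"
      by (rule power_mono) simp
    also have "\<dots> \<le> 27 * (((1 + \<bar>p\<bar>) * \<bar>?U \<omega>\<bar>) ^ 4 + ((1 + \<bar>q\<bar>) * \<bar>?V \<omega>\<bar>) ^ 4 + 2 ^ 4)"
      by (rule power4_sum3_le)
    finally show "remainder n \<omega> ^ 4 \<le> 27 * ((1 + \<bar>p\<bar>) ^ 4 * ?U \<omega> ^ 4 + (1 + \<bar>q\<bar>) ^ 4 * ?V \<omega> ^ 4 + 16)"
      by (simp add: power_mult_distrib)
  qed
  then have "expectation (\<lambda>\<omega>. remainder n \<omega> ^ 4)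
      \<le> expectation (\<lambda>\<omega>. 27 * ((1 + \<bar>p\<bar>) ^ 4 * ?U \<omega> ^ 4 + (1 + \<bar>q\<bar>) ^ 4 * ?V \<omega> ^ 4 + 16))"
    using int by (intro integral_mono_AE integrable_remainder_power) auto
  also have "\<dots> = 27 * ((1 + \<bar>p\<bar>) ^ 4 * expectation (\<lambda>\<omega>. ?U \<omega> ^ 4) + (1 + \<bar>q\<bar>) ^ 4 * expectation (\<lambda>\<omega>. ?V \<omega> ^ 4) + 16)"
    using int by (simp add: prob_space)
  also have "\<dots> \<le> 27 * ((1 + \<bar>p\<bar>) ^ 4 * 48 + (1 + \<bar>q\<bar>) ^ 4 * 48 + 16)"
    using emp_process_moments(3)[OF measurable_ind(1) ind_bound(1), of a n]
      emp_process_moments(3)[OF measurable_ind(2) ind_bound(2), of b n]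
    by (intro mult_left_mono add_mono order_refl) auto
  finally show ?thesis .
qed

text \<open>The influence function of the empirical copula at \<open>(\<alpha>, \<alpha>)\<close> up
  to an additive constant; \<open>emp_process\<close> does the centring.\<close>

definition lin :: "real \<times> real \<Rightarrow> real" where
  "lin z = indXY a b z - p * indX a z - q * indY b z"

lemma lin_bound: "\<bar>lin z\<bar> \<le> 1 + \<bar>p\<bar> + \<bar>q\<bar>"
  by (auto simp: lin_def indXY_def indX_def indY_def)

lemma measurable_lin [measurable]: "lin \<in> borel_measurable borel"
  unfolding lin_def by measurable

text \<open>Indicators are idempotent and the product of the marginal indicators is the joint one,
  so the square of \<open>lin\<close> is again a linear combination of the three indicators. Their
  means are \<open>C \<alpha> \<alpha>\<close>, \<alpha> and \<alpha>.\<close>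

lemma variance_lin: "variance (\<lambda>\<omega>. lin (Z 1 \<omega>)) = sigma2 C \<alpha>"
proof -
  note int = integrable_ind[of 1, OF order_refl]
  have intlin: "integrable M (\<lambda>\<omega>. lin (Z 1 \<omega>))"
    unfolding lin_def using int by simp
  have sq: "(lin z)\<^sup>2 = (1 - 2 * p - 2 * q + 2 * p * q) * indXY a b z + p\<^sup>2 * indX a z + q\<^sup>2 * indY b z" for z
    by (auto simp: lin_def indXY_def indX_def indY_def power2_eq_square algebra_simps)
  have 1: "expectation (\<lambda>\<omega>. lin (Z 1 \<omega>)) = C \<alpha> \<alpha> - p * \<alpha> - q * \<alpha>"
    unfolding lin_def using int expectation_ind cdf_ab by (simp del: One_nat_def)
  have 2: "expectation (\<lambda>\<omega>. (lin (Z 1 \<omega>))\<^sup>2) = (1 - 2 * p - 2 * q + 2 * p * q) * C \<alpha> \<alpha> + p\<^sup>2 * \<alpha> + q\<^sup>2 * \<alpha>"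
    unfolding sq using int expectation_ind cdf_ab by (simp del: One_nat_def)
  have "integrable M (\<lambda>\<omega>. (lin (Z 1 \<omega>))\<^sup>2)" unfolding sq using int by (simp del: One_nat_def)
  then have v: "variance (\<lambda>\<omega>. lin (Z 1 \<omega>)) = (1 - 2 * p - 2 * q + 2 * p * q) * C \<alpha> \<alpha> + p\<^sup>2 * \<alpha> + q\<^sup>2 * \<alpha>
      - (C \<alpha> \<alpha> - p * \<alpha> - q * \<alpha>)\<^sup>2"
    using variance_eq[OF intlin] unfolding 1 2 by (simp only:)
  show ?thesis
    unfolding v by (simp add: sigma2_def diagonal_def Let_def power2_eq_square algebra_simps)
qed

text \<open>An exact identity: the marginal terms in \<open>remainder\<close> cancel those of
  \<open>lin\<close>, leaving the joint process plus the scaled difference of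
  \<open>emp_copula\<close> and \<open>emp_joint\<close>.\<close>

lemma emp_copula_expansion:
  assumes n: "1 \<le> n"
  shows "sqrt (real n) * (emp_copula n (\<lambda>j. X j \<omega>) (\<lambda>j. Y j \<omega>) \<alpha> \<alpha> - C \<alpha> \<alpha>)
    = emp_process lin n \<omega> + remainder n \<omega>"
proof -
  note int = integrable_ind[of 1, OF order_refl]
  have "emp_process lin n \<omega> = emp_process (indXY a b) n \<omega> - p * emp_process (indX a) n \<omega> - q * emp_process (indY b) n \<omega>"
    unfolding lin_def[abs_def] emp_process_mult[symmetric]
    by (subst emp_process_diff, use int in simp, use int in simp, subst emp_process_diff) (use int in simp_all)
  then show ?thesis
    unfolding remainder_def emp_process_indXY[OF n] cdf_ab by (simp add: algebra_simps)
qed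

text \<open>The linear part is centred and for \<open>1 \<le> n\<close> has second moment exactly
  \<open>sigma2 C \<alpha>\<close>; the remainder vanishes in mean square. Hence
  \<open>mean_variance_tendsto_perturbed\<close> yields both limits at once.\<close>

lemma
  shows emp_copula_bias: "(\<lambda>n. sqrt (real n) * (expectation (\<lambda>\<omega>. emp_copula n (\<lambda>j. X j \<omega>) (\<lambda>j. Y j \<omega>) \<alpha> \<alpha>) - C \<alpha> \<alpha>)) \<longlonglongrightarrow> 0"
    and emp_copula_variance: "(\<lambda>n. real n * variance (\<lambda>\<omega>. emp_copula n (\<lambda>j. X j \<omega>) (\<lambda>j. Y j \<omega>) \<alpha> \<alpha>)) \<longlonglongrightarrow> sigma2 C \<alpha>"
proof -
  let ?E = "\<lambda>n \<omega>. emp_copula n (\<lambda>j. X j \<omega>) (\<lambda>j. Y j \<omega>) \<alpha> \<alpha>"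
  note lin = measurable_lin lin_bound
  have int: "integrable M (?E n)" for n
    by (rule integrable_bounded[OF measurable_emp_cdf(4) abs_emp_le(2)])
  have L: "(\<lambda>n. expectation (\<lambda>\<omega>. (emp_process lin n \<omega>)\<^sup>2)) \<longlonglongrightarrow> sigma2 C \<alpha>"
    by (rule tendsto_eventually, rule eventually_mono[OF eventually_ge_at_top[of 1]])
      (simp only: emp_process_moments(2)[OF lin] variance_lin)
  have D: "(\<lambda>n. expectation (\<lambda>\<omega>. (remainder n \<omega>)\<^sup>2)) \<longlonglongrightarrow> 0"
    by (rule second_moment_tendsto_zero[OF measurable_remainder integrable_remainder_power _ remainder_tendsto_prob],
        rule eventually_mono[OF eventually_ge_at_top[of 1]], rule remainder_fourth_moment)
  note lims = mean_variance_tendsto_perturbed[OF measurable_emp_process[OF lin] measurable_remainder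
    integrable_emp_process_power[OF lin] integrable_remainder_power emp_process_moments(1)[OF lin] L D]
  have mean: "expectation (\<lambda>\<omega>. emp_process lin n \<omega> + remainder n \<omega>) = sqrt (real n) * (expectation (?E n) - C \<alpha> \<alpha>)"
    if "1 \<le> n" for n
    unfolding emp_copula_expansion[OF that, symmetric] using int by (simp add: prob_space)
  show "(\<lambda>n. sqrt (real n) * (expectation (?E n) - C \<alpha> \<alpha>)) \<longlonglongrightarrow> 0"
    by (rule Lim_transform_eventually[OF lims(1)], rule eventually_mono[OF eventually_ge_at_top[of 1]]) (rule mean)
  have var: "variance (\<lambda>\<omega>. emp_process lin n \<omega> + remainder n \<omega>) = real n * variance (?E n)" if "1 \<le> n" for n
  proof -
    have "(emp_process lin n \<omega> + remainder n \<omega> - expectation (\<lambda>\<omega>. emp_process lin n \<omega> + remainder n \<omega>))\<^sup>2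
      = real n * (?E n \<omega> - expectation (?E n))\<^sup>2" for \<omega>
      unfolding mean[OF that] unfolding emp_copula_expansion[OF that, symmetric] right_diff_distrib[symmetric]
      by (simp add: power_mult_distrib)
    then show ?thesis by simp
  qed
  show "(\<lambda>n. real n * variance (?E n)) \<longlonglongrightarrow> sigma2 C \<alpha>"
    by (rule Lim_transform_eventually[OF lims(2)], rule eventually_mono[OF eventually_ge_at_top[of 1]]) (rule var)
qed

end

text \<open>The decomposition is the one of \<open>mean_squared_error\<close>, with variance and
  bias governed by \<open>emp_copula_variance\<close> and \<open>emp_copula_bias\<close>. The
  identities start at \<open>n = 1\<close> because at \<open>n = 0\<close> the threshold
  \<open>i n / real n\<close> evaluates to 0 instead of \<alpha>.\<close>

theorem theorem2:
  fixes M :: "'a measure" and X Y :: "nat \<Rightarrow> 'a \<Rightarrow> real"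
    and C :: "real \<Rightarrow> real \<Rightarrow> real" and \<alpha> lamU :: real and i :: "nat \<Rightarrow> real"
  assumes "prob_space M"
    and "iid_pairs M X Y"
    and "continuous_on UNIV (cdf (distr M borel (X 1)))"
    and "continuous_on UNIV (cdf (distr M borel (Y 1)))"
    and "copula_of M (X 1) (Y 1) C"
    and "continuous_partials C"
    and "has_upper_tail_dependence C lamU"
    and "0 < \<alpha>" and "\<alpha> < 1"
    and "\<And>n. i n = \<alpha> * real n"
  shows "\<exists>V r :: nat \<Rightarrow> real.
    (\<forall>n\<ge>1. V n = prob_space.variance M
        (\<lambda>\<omega>. upper_tail_estimator n (\<lambda>j. X j \<omega>) (\<lambda>j. Y j \<omega>) (i n / real n))) \<and>
    (\<forall>n\<ge>1. prob_space.expectation M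
        (\<lambda>\<omega>. (upper_tail_estimator n (\<lambda>j. X j \<omega>) (\<lambda>j. Y j \<omega>) (i n / real n) - lamU)\<^sup>2)
      = V n + ((1 - 2 * \<alpha> + diagonal C \<alpha>) / (1 - \<alpha>) - 2 + left_deriv (diagonal C) 1 + r n)\<^sup>2) \<and>
    r \<in> o(\<lambda>n. 1 / sqrt (real n)) \<and>
    (\<lambda>n. real n * V n) \<longlonglongrightarrow> sigma2 C \<alpha> / (1 - \<alpha>)\<^sup>2"
proof -
  interpret copula_sample M X Y C \<alpha>
    by (intro copula_sample.intro copula_sample_axioms.intro assms)
  define E where "E n \<omega> = emp_copula n (\<lambda>j. X j \<omega>) (\<lambda>j. Y j \<omega>) \<alpha> \<alpha>" for n \<omega>
  define T where "T n \<omega> = upper_tail_estimator n (\<lambda>j. X j \<omega>) (\<lambda>j. Y j \<omega>) (i n / real n)" for n \<omega>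
  \<comment> \<open>The gap between the exact mean of the estimator and its limiting value.\<close>
  define r where "r n = expectation (T n) - (1 - 2 * \<alpha> + diagonal C \<alpha>) / (1 - \<alpha>)" for n
  \<comment> \<open>The estimator is an affine function of the empirical copula with slope
    \<open>1 / (1 - \<alpha>)\<close>. The bias is therefore scaled by this slope and the variance
    by its square.\<close>
  have T: "T n \<omega> = (1 - 2 * \<alpha>) / (1 - \<alpha>) + 1 / (1 - \<alpha>) * E n \<omega>" if "1 \<le> n" for n \<omega>
    using that assms(10)[of n] by (simp add: T_def E_def upper_tail_estimator_def add_divide_distrib)
  have E: "integrable M (E n)" "integrable M (\<lambda>\<omega>. (E n \<omega>)\<^sup>2)" for n
  proof -
    have [measurable]: "random_variable borel (E n)" unfolding E_def by (rule measurable_emp_cdf(4))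
    have bound: "\<bar>E n \<omega>\<bar> \<le> 1" for \<omega> unfolding E_def by (rule abs_emp_le(2))
    show "integrable M (E n)" by (rule integrable_bounded[of _ 1]) (simp_all add: bound)
    show "integrable M (\<lambda>\<omega>. (E n \<omega>)\<^sup>2)"
      by (rule integrable_bounded[of _ 1]) (simp_all add: bound abs_square_le_1)
  qed
  have mean: "expectation (T n) = (1 - 2 * \<alpha>) / (1 - \<alpha>) + 1 / (1 - \<alpha>) * expectation (E n)" if "1 \<le> n" for n
    unfolding T[OF that, abs_def] using E(1)[of n] by (simp add: prob_space)
  have intT: "integrable M (T n)" "integrable M (\<lambda>\<omega>. (T n \<omega>)\<^sup>2)" if "1 \<le> n" for n
    unfolding T[OF that, abs_def] power2_sum power_mult_distrib using E[of n] by simp_all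
  have var: "real n * variance (T n) = real n * variance (E n) / (1 - \<alpha>)\<^sup>2" if "1 \<le> n" for n
  proof -
    have "(T n \<omega> - expectation (T n))\<^sup>2 = (E n \<omega> - expectation (E n))\<^sup>2 / (1 - \<alpha>)\<^sup>2" for \<omega>
      unfolding T[OF that] mean[OF that] by (simp add: power_divide diff_divide_distrib[symmetric])
    then show ?thesis by simp
  qed
  have "expectation (\<lambda>\<omega>. (T n \<omega> - lamU)\<^sup>2)
      = variance (T n) + ((1 - 2 * \<alpha> + diagonal C \<alpha>) / (1 - \<alpha>) - 2 + left_deriv (diagonal C) 1 + r n)\<^sup>2"
    if "1 \<le> n" for n
  proof -
    \<comment> \<open>With this value the limiting terms cancel and the expression inside the square
      is the exact bias \<open>expectation (T n) - lamU\<close>.\<close>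
    have "left_deriv (diagonal C) 1 = 2 - lamU"
      using assms(5,7) by (intro left_deriv_diagonal_copula) (auto simp: copula_of_def)
    then have "(1 - 2 * \<alpha> + diagonal C \<alpha>) / (1 - \<alpha>) - 2 + left_deriv (diagonal C) 1 + r n = expectation (T n) - lamU"
      unfolding r_def by linarith
    then show ?thesis
      using mean_squared_error[OF intT[OF that], of lamU] by (rule ssubst)
  qed
  moreover have "r \<in> o(\<lambda>n. 1 / sqrt (real n))"
  proof (rule smalloI_tendsto)
    have "(\<lambda>n. sqrt (real n) * (expectation (E n) - C \<alpha> \<alpha>) / (1 - \<alpha>)) \<longlonglongrightarrow> 0"
      using emp_copula_bias unfolding E_def by (rule tendsto_divide_zero)
    then show "(\<lambda>n. r n / (1 / sqrt (real n))) \<longlonglongrightarrow> 0"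
    proof (rule Lim_transform_eventually, intro eventually_mono[OF eventually_ge_at_top[of 1]])
      fix n :: nat assume "1 \<le> n"
      then show "sqrt (real n) * (expectation (E n) - C \<alpha> \<alpha>) / (1 - \<alpha>) = r n / (1 / sqrt (real n))"
        unfolding r_def by (simp add: mean diagonal_def add_divide_distrib diff_divide_distrib algebra_simps)
    qed
    show "\<forall>\<^sub>F n in sequentially. 1 / sqrt (real n) \<noteq> 0"
      using eventually_gt_at_top[of 0] by eventually_elim simp
  qed
  moreover have "(\<lambda>n. real n * variance (T n)) \<longlonglongrightarrow> sigma2 C \<alpha> / (1 - \<alpha>)\<^sup>2"
  proof (rule Lim_transform_eventually)
    show "(\<lambda>n. real n * variance (E n) / (1 - \<alpha>)\<^sup>2) \<longlonglongrightarrow> sigma2 C \<alpha> / (1 - \<alpha>)\<^sup>2"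
      using \<alpha> emp_copula_variance unfolding E_def by (intro tendsto_divide tendsto_const) auto
    show "\<forall>\<^sub>F n in sequentially. real n * variance (E n) / (1 - \<alpha>)\<^sup>2 = real n * variance (T n)"
      by (rule eventually_mono[OF eventually_ge_at_top[of 1]]) (rule var[symmetric])
  qed
  ultimately show ?thesis
    unfolding T_def[symmetric] by (intro exI[of _ "\<lambda>n. variance (T n)"] exI[of _ r] conjI allI impI refl)
qed

end
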